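(* Let $q$ be a prime power and let $n,k,t$ be positive integers with $t\leq k-2$ and $2k+t+\min\{4,2t\}\leq n$. Let $V$ be an $n$-dimensional vector space over $\mathbb{F}_q$. If $\mathcal{F}\subseteq{V\brack k}$ is a maximal non-trivial $t$-intersecting family and $$|\mathcal{F}|\geq {k-t\brack 1}{n-t-1\brack k-t-1}-q{k-t\brack 2}{n-t-2\brack k-t-2},$$ then one of the following holds: (i) $\mathcal{F}=\mathcal{H}_2(X,M,C)$ for some $t$-subspace $X$, $k$-subspace $M$ and $c$-subspace $C$ of $V$ with $X\subseteq M\subseteq C$ and $c\in\{k+1,k+2,\ldots,2k-t,n\}$; (ii) $\mathcal{F}=\mathcal{H}_3(Z)$ for some $(t+2)$-subspace $Z$ of $V$, and $\frac{k}{2}-1\leq t\leq k-2$.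
   Context: ${V\brack k}$ denotes the set of all $k$-dimensional subspaces ("$k$-subspaces") of $V$. Gaussian binomial coefficients: ${a\brack b}=\prod_{0\leq i<b}\frac{q^{a-i}-1}{q^{b-i}-1}$ for $b\ge 1$, ${a\brack 0}=1$, and ${a\brack c}=0$ for $c<0$. A family $\mathcal{F}\subseteq{V\brack k}$ is $t$-intersecting if $\dim(A\cap B)\geq t$ for all $A,B\in\mathcal{F}$. A $t$-intersecting family is trivial if all its members contain a common $t$-subspace of $V$, and non-trivial otherwise. It is maximal if it is not properly contained in another $t$-intersecting family in ${V\brack k}$. For subspaces $X\subseteq M\subseteq C$ of $V$ with $\dim X=t$, $\dim M=k$, $\dim C=c\in\{k+1,\ldots,2k-t,n\}$, define $\mathcal{H}_2(X,M,C)=\mathcal{A}(X,M)\cup\mathcal{B}(X,M,C)\cup\mathcal{C}(X,M,C)$, where $\mathcal{A}(X,M)=\{F\in{V\brack k}\mid X\subseteq F,\ \dim(F\cap M)\geq t+1\}$, $\mathcal{B}(X,M,C)=\{F\in{V\brack k}\mid F\cap M=X,\ \dim(F\cap C)=c-k+t\}$, $\mathcal{C}(X,M,C)=\{F\in{C\brack k}\mid \dim(F\cap X)=t-1,\ \dim(F\cap M)=k-1\}$. For a $(t+2)$-subspace $Z$ of $V$, define $\mathcal{H}_3(Z)=\{F\in{V\brack k}\mid\dim(F\cap Z)\geq t+1\}$. *)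

theory Defs
  imports Complex_Main "HOL-Library.Cardinality"
begin

text \<open>
  A vector space is given by its scalar multiplication \<open>s\<close>, as in the library locale
  \<open>vector_space\<close>; the vectors are all elements of the underlying type.
\<close>

definition subspaces :: "('f::field \<Rightarrow> 'v::ab_group_add \<Rightarrow> 'v) \<Rightarrow> nat \<Rightarrow> 'v set set" where
  "subspaces s k = {F. module.subspace s F \<and> vector_space.dim s F = k}"

text \<open>
  The arguments are integers, so that differences in them are not truncated.
\<close>

definition gauss_binomial :: "nat \<Rightarrow> int \<Rightarrow> int \<Rightarrow> real" where
  "gauss_binomial q a b =
     (if b < 0 then 0
      else \<Prod>i\<in>{0..<b}. (real q powi (a - i) - 1) / (real q powi (b - i) - 1))"

definition t_intersecting ::
    "('f::field \<Rightarrow> 'v::ab_group_add \<Rightarrow> 'v) \<Rightarrow> nat \<Rightarrow> 'v set set \<Rightarrow> bool" where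
  "t_intersecting s t \<F> \<longleftrightarrow> (\<forall>A\<in>\<F>. \<forall>B\<in>\<F>. vector_space.dim s (A \<inter> B) \<ge> t)"

definition trivial_family ::
    "('f::field \<Rightarrow> 'v::ab_group_add \<Rightarrow> 'v) \<Rightarrow> nat \<Rightarrow> 'v set set \<Rightarrow> bool" where
  "trivial_family s t \<F> \<longleftrightarrow> (\<exists>T\<in>subspaces s t. \<forall>F\<in>\<F>. T \<subseteq> F)"

definition maximal_t_intersecting ::
    "('f::field \<Rightarrow> 'v::ab_group_add \<Rightarrow> 'v) \<Rightarrow> nat \<Rightarrow> nat \<Rightarrow> 'v set set \<Rightarrow> bool" where
  "maximal_t_intersecting s k t \<F> \<longleftrightarrow>
     \<F> \<subseteq> subspaces s k \<and> t_intersecting s t \<F> \<and>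
     \<not> (\<exists>\<G>. \<G> \<subseteq> subspaces s k \<and> t_intersecting s t \<G> \<and> \<F> \<subset> \<G>)"

definition family_A ::
    "('f::field \<Rightarrow> 'v::ab_group_add \<Rightarrow> 'v) \<Rightarrow> nat \<Rightarrow> nat \<Rightarrow> 'v set \<Rightarrow> 'v set \<Rightarrow> 'v set set" where
  "family_A s k t X M =
     {F \<in> subspaces s k. X \<subseteq> F \<and> vector_space.dim s (F \<inter> M) \<ge> t + 1}"

text \<open>
  In the following two families the subtractions on natural numbers are exact, since
  \<open>dim C > k\<close> and \<open>k > t \<ge> 1\<close> whenever the families are used.
\<close>

definition family_B ::
    "('f::field \<Rightarrow> 'v::ab_group_add \<Rightarrow> 'v) \<Rightarrow> nat \<Rightarrow> nat \<Rightarrow> 'v set \<Rightarrow> 'v set \<Rightarrow> 'v set \<Rightarrow> 'v set set"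
  where
  "family_B s k t X M C =
     {F \<in> subspaces s k. F \<inter> M = X \<and>
        vector_space.dim s (F \<inter> C) = vector_space.dim s C - k + t}"

definition family_C ::
    "('f::field \<Rightarrow> 'v::ab_group_add \<Rightarrow> 'v) \<Rightarrow> nat \<Rightarrow> nat \<Rightarrow> 'v set \<Rightarrow> 'v set \<Rightarrow> 'v set \<Rightarrow> 'v set set"
  where
  "family_C s k t X M C =
     {F \<in> subspaces s k. F \<subseteq> C \<and>
        vector_space.dim s (F \<inter> X) = t - 1 \<and> vector_space.dim s (F \<inter> M) = k - 1}"

definition H2 ::
    "('f::field \<Rightarrow> 'v::ab_group_add \<Rightarrow> 'v) \<Rightarrow> nat \<Rightarrow> nat \<Rightarrow> 'v set \<Rightarrow> 'v set \<Rightarrow> 'v set \<Rightarrow> 'v set set"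
  where
  "H2 s k t X M C = family_A s k t X M \<union> family_B s k t X M C \<union> family_C s k t X M C"

definition H3 ::
    "('f::field \<Rightarrow> 'v::ab_group_add \<Rightarrow> 'v) \<Rightarrow> nat \<Rightarrow> nat \<Rightarrow> 'v set \<Rightarrow> 'v set set" where
  "H3 s k t Z = {F \<in> subspaces s k. vector_space.dim s (F \<inter> Z) \<ge> t + 1}"

end

theory Submission
  imports Defs
begin

text \<open>
  Call a subspace a cover if it meets every member of the family in dimension at least \<open>t\<close>.
  If \<open>S\<close> is not a cover, some member \<open>F'\<close> meets \<open>S\<close> in dimension less than \<open>t\<close>, so each member
  above \<open>S\<close> contains one of at most \<open>(q^(k+1-t) - 1)/(q - 1)\<close> subspaces \<open>S + \<langle>v\<rangle>\<close> with
  \<open>v \<in> F'\<close>. Iterating this until the dimension of a smallest cover is reached shows that the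
  family is too small unless there are covers of dimension \<open>t + 1\<close>. By maximality two such covers
  meet in dimension \<open>t\<close>. A single one again makes the family too small; three without a common
  \<open>t\<close>-subspace span a \<open>(t+2)\<close>-space \<open>Z\<close> and force \<open>H3\<close>; otherwise all contain a \<open>t\<close>-space \<open>X\<close>,
  and their sum \<open>M\<close> lies in \<open>X + F\<close> for every member \<open>F\<close> not above \<open>X\<close>, so that
  \<open>dim M \<le> k + 1\<close>. The values \<open>k + 1\<close> and \<open>k\<close> of \<open>dim M\<close> give \<open>H2\<close>, smaller ones are excluded
  by counting.
\<close>

section \<open>Gaussian binomial coefficients and numerical estimates\<close>

text \<open>The threshold is a lower bound for the size of \<open>family_A\<close> when
  \<open>dim M = k\<close>: a \<open>k\<close>-space through \<open>X\<close> that meets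
  \<open>M\<close> in dimension \<open>t + j\<close> is counted \<open>[j, 1] - q * [j, 2]\<close>
  times by its two terms, which is \<open>0\<close> for \<open>j = 0\<close>, \<open>1\<close> for
  \<open>j = 1\<close> and \<open>j = 2\<close>, and negative for larger \<open>j\<close>. Every
  upper bound is compared with it after division by the number of \<open>k\<close>-spaces through a
  \<open>(t+2)\<close>-space. What remains are inequalities in \<open>q\<close>,
  \<open>e = k - t - 1\<close> and the ratio \<open>\<rho>\<close> of the numbers of
  \<open>k\<close>-spaces through a \<open>(t+1)\<close>-space and a \<open>(t+2)\<close>-space,
  with \<open>\<rho> \<ge> q^(n-k)\<close>. The critical case is that of no cover of dimension
  \<open>t + 1\<close>. Up to constants its bound is \<open>q^(2e+2t+2)\<close>, against a threshold
  of \<open>q^e * \<rho>\<close>. The hypothesis on \<open>n\<close> leaves a margin of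
  \<open>q^3\<close> for \<open>t \<ge> 2\<close>, but only of \<open>q\<close> for
  \<open>t = 1\<close>, and at \<open>q = 2\<close> the neglected constants can exceed this; hence
  the finer counts for \<open>t = 1\<close>.\<close>

lemma gauss_binomial_rec:
  assumes "b \<ge> 1"
  shows "gauss_binomial q a b =
    (real q powi a - 1) / (real q powi b - 1) * gauss_binomial q (a - 1) (b - 1)"
proof -
  let ?f = "\<lambda>i. (real q powi (a - i) - 1) / (real q powi (b - i) - 1)"
  have "{0..<b} = insert 0 {1..<b}" using assms by auto
  then have "gauss_binomial q a b = ?f 0 * prod ?f {1..<b}"
    using assms by (simp add: gauss_binomial_def)
  also have "prod ?f {1..<b} = (\<Prod>i\<in>{0..<b - 1}. ?f (i + 1))"
    by (rule prod.reindex_bij_witness[of _ "\<lambda>i. i + 1" "\<lambda>i. i - 1"]) auto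
  also have "\<dots> = gauss_binomial q (a - 1) (b - 1)"
    using assms by (simp add: gauss_binomial_def algebra_simps)
  finally show ?thesis by simp
qed

lemma gauss_binomial_Suc:
  "gauss_binomial q (int (Suc a)) (int (Suc b)) =
    (real q ^ Suc a - 1) / (real q ^ Suc b - 1) * gauss_binomial q (int a) (int b)"
  using gauss_binomial_rec[of "int (Suc b)" q "int (Suc a)"]
  by (simp del: of_nat_Suc power_Suc add: power_int_of_nat) simp

lemma gauss_binomial_0 [simp]: "gauss_binomial q a 0 = 1"
  by (simp add: gauss_binomial_def)

lemma gauss_binomial_neg [simp]: "b < 0 \<Longrightarrow> gauss_binomial q a b = 0"
  by (simp add: gauss_binomial_def)

lemma gauss_binomial_pos:
  assumes "q \<ge> 2" "b \<le> a" shows "gauss_binomial q (int a) (int b) > 0"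
  using assms(2)
proof (induction b arbitrary: a)
  case (Suc b)
  then obtain a' where a': "a = Suc a'" "b \<le> a'" by (cases a) auto
  have "real q ^ Suc m > 1" for m using assms(1) by (intro one_less_power) auto
  then show ?case unfolding a'(1) gauss_binomial_Suc using Suc.IH[OF a'(2)] by simp
qed simp

text \<open>The number of one-dimensional subspaces of a \<open>d\<close>-space; the numerical
  estimates are phrased through it.\<close>

definition q_number :: "nat \<Rightarrow> nat \<Rightarrow> real" where
  "q_number q d = (real q ^ d - 1) / (real q - 1)"

lemma q_number_0 [simp]: "q_number q 0 = 0"
  by (simp add: q_number_def)

lemma gauss_binomial_1: "gauss_binomial q (int a) 1 = q_number q a"
  using gauss_binomial_rec[of 1 q "int a"] by (simp add: q_number_def power_int_of_nat)

lemma q_number_pos: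
  assumes "q \<ge> 2" "0 < d" shows "q_number q d > 0"
proof -
  have "real q ^ d > 1" using assms by (intro one_less_power) auto
  then show ?thesis using assms by (simp add: q_number_def)
qed

lemma q_number_nonneg: "q \<ge> 2 \<Longrightarrow> q_number q d \<ge> 0"
  by (simp add: q_number_def)

text \<open>The product telescopes; by duality the value is also the number of points. It serves to
  count the hyperplanes of a \<open>(t+1)\<close>-dimensional cover, of \<open>Z\<close> and of
  \<open>M\<close>.\<close>

lemma gauss_binomial_hyperplanes:
  assumes "q \<ge> 2" shows "gauss_binomial q (int (Suc d)) (int d) = q_number q (Suc d)"
proof (induction d)
  case 0
  show ?case using assms by (simp add: q_number_def)
next
  case (Suc d)
  have "real q ^ Suc d > 1" using assms by (intro one_less_power) auto
  then show ?case unfolding gauss_binomial_Suc[of q "Suc d" d] Suc by (simp add: q_number_def)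
qed

section \<open>Estimates for q-numbers and comparisons of upper bounds with the threshold\<close>

context
  fixes q :: nat
  assumes q2: "q \<ge> 2"
begin

lemma q_number_Suc: "q_number q (Suc d) = real q * q_number q d + 1"
  using q2 by (simp add: q_number_def field_simps)

lemma q_number_mult: "(real q - 1) * q_number q d = real q ^ d - 1"
  using q2 by (simp add: q_number_def)

lemma q_number_less: "q_number q d < real q ^ d"
proof (induction d)
  case (Suc d)
  have "q_number q d + 1 \<le> real q ^ d"
    using Suc.IH q2 q_number_mult[of d] mult_right_mono[of 1 "real q - 1" "q_number q d"]
      q_number_nonneg[OF q2, of d] by simp
  then have "real q * (q_number q d + 1) \<le> real q * real q ^ d"
    by (intro mult_left_mono) auto
  then show ?case using q2 by (simp add: q_number_Suc algebra_simps)
qed simp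

lemma q_number_ge: "real q ^ d \<le> q_number q (Suc d)"
proof (induction d)
  case (Suc d)
  then have "real q * real q ^ d \<le> real q * q_number q (Suc d)" by (intro mult_left_mono) auto
  then show ?case by (simp add: q_number_Suc[of "Suc d"])
qed (simp add: q_number_Suc)

lemma q_number_add: "q_number q (i + d) = q_number q i + real q ^ i * q_number q d"
  by (induction i) (simp_all add: q_number_Suc algebra_simps)

lemma q_number_mono: "i \<le> d \<Longrightarrow> q_number q i \<le> q_number q d"
  using q_number_add[of i "d - i"] q_number_nonneg[OF q2, of "d - i"] by simp

text \<open>Equality holds for \<open>q = 2\<close>, \<open>d = 0\<close>, so the ratio
  \<open>3/4\<close> is best possible. The quarter left over absorbs the correction term in
  \<open>unique_cover_bound_less\<close>.\<close>

lemma q_number_le_square: "4 * q_number q (Suc (Suc d)) \<le> 3 * (real q ^ Suc d)\<^sup>2"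
proof (induction d)
  case 0
  have "0 \<le> (real q - 2) * (3 * real q + 2)" using q2 by simp
  then show ?case using q2
    by (simp add: q_number_Suc power2_eq_square algebra_simps)
next
  case (Suc d)
  define y where "y = (real q ^ Suc d)\<^sup>2"
  have y: "1 \<le> y" unfolding y_def using q2 by (intro one_le_power) simp
  have "4 * q_number q (Suc (Suc (Suc d))) = real q * (4 * q_number q (Suc (Suc d))) + 4"
    by (simp add: q_number_Suc)
  also have "\<dots> \<le> real q * (3 * y) + 4 * y"
    using Suc.IH y unfolding y_def by (intro add_mono mult_left_mono) auto
  also have "\<dots> = (3 * real q + 4) * y" by (simp add: algebra_simps)
  also have "\<dots> \<le> (3 * (real q)\<^sup>2) * y"
  proof (rule mult_right_mono)
    have "0 \<le> (real q - 2) * (3 * real q + 3)" using q2 by simp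
    moreover have "2 \<le> real q" using q2 by simp
    ultimately show "3 * real q + 4 \<le> 3 * (real q)\<^sup>2"
      by (simp add: power2_eq_square algebra_simps)
  qed (use y in simp)
  also have "\<dots> = 3 * (real q ^ Suc (Suc d))\<^sup>2" by (simp add: y_def power_mult_distrib)
  finally show ?case .
qed

text \<open>To be read with \<open>e = k - t - 1\<close> and \<open>m = n - t - 1\<close>. By
  \<open>q_number_Suc\<close> and the exact relation for \<open>\<rho>\<close>, the product
  \<open>q_number q (Suc e) * \<rho>\<close> is \<open>\<rho> + q * q_number q m\<close>; so
  \<open>\<rho>\<close> cancels and a comparison with \<open>q_number q m\<close> remains.
  Multiplying it by \<open>q - 1\<close> turns q-numbers into powers.\<close>

lemma unique_cover_bound_less:
  assumes "0 < e" "0 < t" "\<rho> * q_number q e = q_number q m" "2 * e + 2 * t + 3 \<le> m"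
  shows "\<rho> + q_number q (Suc t) * (real q * q_number q (Suc e) * q_number q (Suc (Suc e)))
    < q_number q (Suc e) * \<rho> - real q * (q_number q (Suc e) * q_number q e / (real q + 1))"
proof -
  define Q x y z where "Q = real q" and "x = real q ^ Suc e" and "y = (real q ^ t)\<^sup>2"
    and "z = q_number q (Suc e)"
  have Q: "2 \<le> Q" using q2 by (simp add: Q_def)
  have x: "Q ^ 2 \<le> x" unfolding Q_def x_def using assms(1) q2 by (intro power_increasing) auto
  have y: "Q ^ 2 \<le> y" unfolding Q_def y_def power_mult[symmetric]
    using assms(2) q2 by (intro power_increasing) auto
  have Q4: "4 \<le> Q ^ 2" using power_mono[OF Q, of 2] by simp
  have z0: "0 \<le> z" "z \<le> x" unfolding z_def x_def
    using q_number_nonneg[OF q2] q_number_less less_imp_le by blast+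
  have Qe: "(Q - 1) * q_number q e \<le> x / Q"
    using q_number_mult[of e] Q unfolding Q_def x_def by simp
  have S: "4 * q_number q (Suc t) \<le> 3 * y"
    using q_number_le_square[of "t - 1"] assms(2) by (simp add: y_def)
  have zQ: "(Q - 1) * q_number q (Suc (Suc e)) = Q * x - 1"
    using q_number_mult[of "Suc (Suc e)"] by (simp add: Q_def x_def)
  have big: "Q * (x\<^sup>2 * y) - 1 \<le> (Q - 1) * q_number q m"
  proof -
    have "Q * (x\<^sup>2 * y) = real q ^ (2 * e + 2 * t + 3)"
      by (simp add: Q_def x_def y_def power_add power_mult[symmetric] power2_eq_square
          mult.commute[of _ "2::nat"] mult_2 numeral_3_eq_3)
    also have "\<dots> \<le> real q ^ m" using assms(4) q2 by (intro power_increasing) auto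
    finally show ?thesis using q_number_mult[of m] by (simp add: Q_def)
  qed
  have t1: "(Q - 1) * (4 * q_number q (Suc t) * z * q_number q (Suc (Suc e))) \<le> 3 * y * x * (Q * x)"
  proof -
    have "(Q - 1) * (4 * q_number q (Suc t) * z * q_number q (Suc (Suc e)))
        = 4 * q_number q (Suc t) * z * (Q * x - 1)" by (simp add: zQ[symmetric])
    also have "\<dots> \<le> 3 * y * x * (Q * x)"
    proof (rule mult_mono[OF mult_mono[OF S z0(2)]])
      show "0 \<le> Q * x - 1" using zQ Q q_number_nonneg[OF q2] by (metis diff_ge_0_iff_ge mult_nonneg_nonneg order_trans one_le_numeral)
      show "0 \<le> 3 * y" "0 \<le> 3 * y * x" using x y Q4 by auto
    qed (use S z0 in auto)
    finally show ?thesis .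
  qed
  have t2: "(Q - 1) * (z * q_number q e / (Q + 1)) \<le> x * (x / Q)"
  proof -
    have "(Q - 1) * (z * q_number q e / (Q + 1)) = z * ((Q - 1) * q_number q e) / (Q + 1)" by simp
    also have "\<dots> \<le> z * ((Q - 1) * q_number q e) / 1"
      using z0 Q q_number_nonneg[OF q2] by (intro divide_left_mono) auto
    also have "\<dots> \<le> x * (x / Q)" unfolding div_by_1
      by (rule mult_mono[OF z0(2) Qe]) (use z0 Q q_number_nonneg[OF q2] in auto)
    finally show ?thesis .
  qed
  have t3: "4 * (x * (x / Q)) + 4 < Q * (x\<^sup>2 * y)"
  proof -
    have "x * (x / Q) \<le> x * (x / 2)" using Q x Q4 by (intro mult_left_mono divide_left_mono) auto
    then have "4 * (x * (x / Q)) + 4 \<le> 2 * x\<^sup>2 + 4" by (simp add: power2_eq_square)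
    also have "\<dots> < 8 * x\<^sup>2"
      using power_mono[of 4 x 2] x Q4 by simp
    also have "\<dots> \<le> (Q * y) * x\<^sup>2"
      using mult_mono[of 2 Q 4 y] Q y Q4 by (intro mult_right_mono) auto
    finally show ?thesis by (simp add: mult_ac)
  qed
  have "(Q - 1) * (q_number q (Suc t) * z * q_number q (Suc (Suc e)) + z * q_number q e / (Q + 1))
      < (Q - 1) * q_number q m"
  proof -
    have "4 * ((Q - 1) * (q_number q (Suc t) * z * q_number q (Suc (Suc e)))) \<le> 3 * (Q * (x\<^sup>2 * y))"
      using t1 by (simp add: power2_eq_square mult_ac)
    then show ?thesis
      using t2 t3 big distrib_left[of "Q - 1" "q_number q (Suc t) * z * q_number q (Suc (Suc e))"
          "z * q_number q e / (Q + 1)"] by linarith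
  qed
  then have "q_number q (Suc t) * z * q_number q (Suc (Suc e)) + z * q_number q e / (Q + 1)
      < q_number q m"
    using Q by simp
  then have "Q * (q_number q (Suc t) * z * q_number q (Suc (Suc e)) + z * q_number q e / (Q + 1))
      < Q * q_number q m" using Q by simp
  moreover have "z * \<rho> = \<rho> + Q * q_number q m"
    unfolding z_def assms(3)[symmetric] by (simp add: q_number_Suc Q_def algebra_simps)
  ultimately show ?thesis unfolding z_def[symmetric] Q_def[symmetric] by (simp add: algebra_simps)
qed

text \<open>The gap between \<open>q_number q (Suc e)\<close> and \<open>q_number q j\<close> is
  \<open>q^j * c\<close> with \<open>c = q_number q (Suc e - j) \<ge> 1\<close>. All other terms are
  bounded by multiples of \<open>q^j * c\<close>, so this factor cancels and
  \<open>(q + 1 + q^t) * q^(e+2) + q^(e+1) \<le> \<rho>\<close> suffices.\<close>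

lemma star_bound_less:
  assumes "0 < t" "2 \<le> j" "j \<le> e" "real q ^ (e + 2 * t + 3) \<le> \<rho>"
  shows "q_number q j * \<rho> + (real q ^ j * q_number q (Suc (Suc e) - j) + q_number q (t + j)) *
      q_number q (Suc (Suc e))
    < q_number q (Suc e) * \<rho> - real q * (q_number q (Suc e) * q_number q e / (real q + 1))"
proof -
  define Q x T y c where "Q = real q" and "x = real q ^ Suc e" and "T = real q ^ t"
    and "y = real q ^ j" and "c = q_number q (Suc e - j)"
  have Q: "2 \<le> Q" using q2 by (simp add: Q_def)
  have T: "Q \<le> T" unfolding Q_def T_def using assms(1) q2 by (intro self_le_power) auto
  have x0: "1 \<le> x" "1 \<le> y" unfolding x_def y_def using q2
    by (auto intro!: one_le_power simp del: power_Suc)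
  have diff: "q_number q (Suc e) = q_number q j + y * c"
    using q_number_add[of j "Suc e - j"] assms(3) by (simp add: y_def c_def)
  have c1: "1 \<le> c"
    using q_number_mono[of 1 "Suc e - j"] assms(3) q2 by (simp add: c_def q_number_def)
  have yc: "1 \<le> y * c" using mult_mono[of 1 y 1 c] x0 c1 by simp
  have c2: "q_number q (Suc (Suc e) - j) \<le> (Q + 1) * c"
    using assms(3) c1 q_number_Suc[of "Suc e - j"] by (simp add: Suc_diff_le c_def Q_def algebra_simps)
  have c3: "q_number q (t + j) \<le> T * (y * c)"
  proof -
    have "q_number q (t + j) \<le> T * y * 1"
      using q_number_less[of "t + j"] by (simp add: T_def y_def power_add less_imp_le)
    also have "\<dots> \<le> T * y * c" using c1 by (intro mult_left_mono) (auto simp: T_def y_def)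
    finally show ?thesis by (simp add: mult_ac)
  qed
  have c4: "q_number q e \<le> y * c"
  proof -
    have "q_number q e \<le> real q ^ e" using q_number_less less_imp_le by blast
    also have "\<dots> = y * real q ^ (e - j)" using assms(3) by (simp add: y_def power_add[symmetric])
    also have "\<dots> \<le> y * c"
      using q_number_ge[of "e - j"] assms(3)
      by (intro mult_left_mono) (auto simp: c_def y_def Suc_diff_le)
    finally show ?thesis .
  qed
  have A: "(Q + 1 + T) * (Q * x) + x \<le> \<rho>"
  proof -
    have "(Q + 1 + T) * Q + 1 \<le> T\<^sup>2 * Q\<^sup>2"
    proof -
      have "Q * T \<le> (Q * T) * (Q * T) / 4"
        using mult_mono[of 2 Q 2 T] Q T mult_left_mono[of 4 "Q * T" "Q * T"] by simp
      moreover have "Q * Q \<le> Q * T" "2 * Q \<le> Q * Q" "4 \<le> Q * Q" using Q T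
          mult_mono[of 2 Q 2 Q] by (auto intro: mult_mono)
      moreover have "4 \<le> Q * T" using mult_mono[of 2 Q 2 T] Q T by simp
      ultimately show ?thesis by (simp add: power2_eq_square algebra_simps)
    qed
    from mult_right_mono[OF this, of x] x0
    have "(Q + 1 + T) * (Q * x) + x \<le> T\<^sup>2 * Q\<^sup>2 * x" by (simp add: algebra_simps)
    also have "\<dots> = real q ^ (e + 2 * t + 3)"
      by (simp add: Q_def x_def T_def power_add power_mult[symmetric] power2_eq_square
          mult.commute[of _ "2::nat"] mult_2 numeral_3_eq_3)
    finally show ?thesis using assms(4) by simp
  qed
  have b2: "q_number q (Suc (Suc e)) < Q * x"
    using q_number_less[of "Suc (Suc e)"] by (simp add: Q_def x_def)
  have b1: "q_number q (Suc e) \<le> x" using q_number_less[of "Suc e"] by (simp add: x_def)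
  have n: "0 \<le> q_number q d" for d by (rule q_number_nonneg[OF q2])
  have "y * q_number q (Suc (Suc e) - j) + q_number q (t + j) \<le> y * ((Q + 1) * c) + T * (y * c)"
    using c2 c3 x0 by (intro add_mono mult_left_mono) auto
  also have "\<dots> = (y * c) * (Q + 1 + T)" by (simp add: algebra_simps)
  finally have s1: "(y * q_number q (Suc (Suc e) - j) + q_number q (t + j)) * q_number q (Suc (Suc e))
      \<le> (y * c) * (Q + 1 + T) * q_number q (Suc (Suc e))"
    using n by (intro mult_right_mono) auto
  also have "\<dots> < (y * c) * (Q + 1 + T) * (Q * x)"
    using b2 yc Q T x0 c1 by (intro mult_strict_left_mono mult_pos_pos) auto
  finally have s1: "(y * q_number q (Suc (Suc e) - j) + q_number q (t + j)) * q_number q (Suc (Suc e))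
      < (y * c) * (Q + 1 + T) * (Q * x)" .
  have "Q * (q_number q (Suc e) * q_number q e / (Q + 1)) = (Q / (Q + 1)) * (q_number q (Suc e) * q_number q e)"
    by simp
  also have "\<dots> \<le> 1 * (x * (y * c))"
    using Q b1 c4 n x0 by (intro mult_mono) auto
  finally have s2: "Q * (q_number q (Suc e) * q_number q e / (Q + 1)) \<le> (y * c) * x" by (simp add: mult_ac)
  have "(y * c) * ((Q + 1 + T) * (Q * x) + x) \<le> (y * c) * \<rho>"
    using A yc by (intro mult_left_mono) auto
  then have "(y * c) * ((Q + 1 + T) * (Q * x)) + (y * c) * x \<le> (y * c) * \<rho>"
    by (simp only: distrib_left[of "y * c" "(Q + 1 + T) * (Q * x)" x])
  then have "(y * c) * (Q + 1 + T) * (Q * x) + (y * c) * x \<le> (y * c) * \<rho>"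
    by (simp only: mult.assoc)
  moreover have "q_number q (Suc e) * \<rho> = q_number q j * \<rho> + (y * c) * \<rho>"
    by (simp add: diff distrib_right)
  ultimately show ?thesis using s1 s2 unfolding y_def[symmetric] unfolding Q_def[symmetric] by linarith
qed

text \<open>With \<open>e = k - t - 1\<close> the first assumption says
  \<open>2 * t + 3 \<le> k\<close>. It leaves a gap of at least \<open>q^e\<close> between
  \<open>q_number q (Suc e)\<close> and \<open>q_number q (t + 2)\<close>, while the correction term
  is below \<open>q^e * \<rho>\<close>.\<close>

lemma H3_bound_less:
  assumes "t + 2 \<le> e" "real q ^ (e + 2 * t + 3) \<le> \<rho>"
  shows "q_number q (t + 2) * \<rho>
    < q_number q (Suc e) * \<rho> - real q * (q_number q (Suc e) * q_number q e / (real q + 1))"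
proof -
  have n: "0 \<le> q_number q d" for d by (rule q_number_nonneg[OF q2])
  have "real q ^ Suc e \<le> real q ^ (e + 2 * t + 3)" using q2 by (intro power_increasing) auto
  then have \<rho>: "q_number q (Suc e) < \<rho>" using q_number_less[of "Suc e"] assms(2) by simp
  have "real q * (q_number q (Suc e) * q_number q e / (real q + 1))
      = real q / (real q + 1) * (q_number q (Suc e) * q_number q e)" by simp
  also have "\<dots> \<le> 1 * (q_number q (Suc e) * q_number q e)"
    using n by (intro mult_right_mono) auto
  also have "\<dots> \<le> q_number q (Suc e) * real q ^ e"
    using n q_number_less[of e] by (simp add: mult_left_mono)
  also have "\<dots> < \<rho> * real q ^ e" using \<rho> q2 by (intro mult_strict_right_mono) auto
  finally have 1: "real q * (q_number q (Suc e) * q_number q e / (real q + 1)) < \<rho> * real q ^ e" .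
  have "q_number q (Suc e) = q_number q e + real q ^ e"
    using q_number_add[of e 1] q2 by (simp add: q_number_def)
  then have "q_number q (t + 2) + real q ^ e \<le> q_number q (Suc e)"
    using q_number_mono[OF assms(1)] by simp
  then have "(q_number q (t + 2) + real q ^ e) * \<rho> \<le> q_number q (Suc e) * \<rho>"
    using \<rho> n[of "Suc e"] by (intro mult_right_mono) auto
  then show ?thesis using 1 by (simp add: algebra_simps)
qed

text \<open>Raises the upper index alone, whereas \<open>gauss_binomial_Suc\<close> raises both
  indices.\<close>

lemma gauss_binomial_Suc_left:
  "t \<le> m \<Longrightarrow> gauss_binomial q (int (Suc m)) (int t) * (real q ^ (Suc m - t) - 1) =
    (real q ^ Suc m - 1) * gauss_binomial q (int m) (int t)"
proof (induction t arbitrary: m)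
  case (Suc t)
  then obtain m' where m: "m = Suc m'" "t \<le> m'" by (cases m) auto
  have "gauss_binomial q (int (Suc m)) (int (Suc t)) * (real q ^ (Suc m - Suc t) - 1)
      = (real q ^ Suc m - 1) / (real q ^ Suc t - 1) *
        (gauss_binomial q (int (Suc m')) (int t) * (real q ^ (Suc m' - t) - 1))"
    unfolding gauss_binomial_Suc m by simp
  also have "\<dots> = (real q ^ Suc m - 1) * gauss_binomial q (int m) (int (Suc t))"
    unfolding Suc.IH[OF m(2)] m(1) gauss_binomial_Suc by simp
  finally show ?case .
qed simp

text \<open>The subtracted term is at most \<open>q_number q (Suc e) * q_number q e\<close>, and
  \<open>q_number q e < q^e \<le> q^(e+1) / 2\<close>. The weaker threshold has the factor
  \<open>q_number q (Suc e)\<close> in front, which can be cancelled in the comparisons that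
  follow.\<close>

lemma bound_ge:
  "q_number q (Suc e) * (\<rho> - real q ^ Suc e / 2)
    \<le> q_number q (Suc e) * \<rho> - real q * (q_number q (Suc e) * q_number q e / (real q + 1))"
proof -
  have n: "0 \<le> q_number q d" for d by (rule q_number_nonneg[OF q2])
  have "real q * (q_number q (Suc e) * q_number q e / (real q + 1))
      = real q / (real q + 1) * (q_number q (Suc e) * q_number q e)" by simp
  also have "\<dots> \<le> 1 * (q_number q (Suc e) * q_number q e)"
    using n by (intro mult_right_mono) auto
  also have "\<dots> \<le> q_number q (Suc e) * (real q ^ Suc e / 2)"
  proof -
    have "2 * real q ^ e \<le> real q ^ Suc e" using q2 by (simp add: mult_right_mono)
    then have "q_number q e \<le> real q ^ Suc e / 2" using q_number_less[of e] by simp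
    then show ?thesis unfolding mult_1 using n by (rule mult_left_mono)
  qed
  finally show ?thesis by (simp add: right_diff_distrib)
qed

text \<open>Since \<open>q_number q (Suc e) \<ge> q + 1 \<ge> 3\<close>, the summand
  \<open>1\<close> of the recursion is at most a third of it.\<close>

lemma q_number_Suc_le:
  assumes "0 < e"
  shows "q_number q (Suc (Suc e)) \<le> (real q + 1 / 3) * q_number q (Suc e)"
proof -
  have "q_number q (Suc (Suc 0)) \<le> q_number q (Suc e)" using assms by (intro q_number_mono) auto
  moreover have "q_number q (Suc (Suc 0)) = real q + 1" by (simp add: q_number_Suc)
  ultimately have "3 \<le> q_number q (Suc e)" using q2 by linarith
  then show ?thesis using q_number_Suc[of "Suc e"] by (simp add: algebra_simps)
qed

text \<open>Only one of the two factors becomes a power of \<open>q\<close>; the other is kept as a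
  multiple of \<open>q_number q (Suc e)\<close>, to cancel against the threshold.\<close>

lemma q_number_square_le:
  assumes "0 < e"
  shows "q_number q (Suc (Suc e)) ^ 2
    \<le> q_number q (Suc e) * ((real q + 1 / 3) * (real q * real q ^ Suc e))"
proof -
  have "q_number q (Suc (Suc e)) ^ 2
      \<le> ((real q + 1 / 3) * q_number q (Suc e)) * (real q * real q ^ Suc e)"
    unfolding power2_eq_square
    using q_number_Suc_le[OF assms] q_number_less[of "Suc (Suc e)"] q_number_nonneg[OF q2]
    by (intro mult_mono) auto
  then show ?thesis by (simp add: mult_ac)
qed

lemma chain_bound_less:
  assumes "0 < e" "2 \<le> t" "real q ^ (e + 2 * t + 5) \<le> \<rho>"
  shows "gauss_binomial q (int (Suc (Suc t))) (int t) * q_number q (Suc (Suc e)) ^ 2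
    < q_number q (Suc e) * \<rho> - real q * (q_number q (Suc e) * q_number q e / (real q + 1))"
proof -
  define Q x y z g where "Q = real q" and "x = real q ^ Suc e" and "y = (real q ^ t)\<^sup>2"
    and "z = q_number q (Suc e)" and "g = gauss_binomial q (int (Suc (Suc t))) (int t)"
  have Q: "2 \<le> Q" using q2 by (simp add: Q_def)
  have x: "0 < x" and z: "0 < z" using q2 q_number_pos[OF q2] by (simp_all add: x_def z_def)
  have y: "4 \<le> y"
  proof -
    have "(2::real) ^ 2 \<le> real q ^ (t * 2)"
      using q2 assms(2) order_trans[OF power_mono[of 2 "real q" 2] power_increasing[of 2 "t * 2" "real q"]]
      by simp
    then show ?thesis by (simp add: y_def power_mult)
  qed
  have g: "g * (Q\<^sup>2 - 1) \<le> Q ^ 3 * y"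
  proof -
    have "g * (Q\<^sup>2 - 1) = (real q ^ Suc (Suc t) - 1) * q_number q (Suc t)"
      using gauss_binomial_Suc_left[of t "Suc t"] gauss_binomial_hyperplanes[OF q2, of t]
      by (simp add: g_def Q_def numeral_2_eq_2 Suc_diff_le)
    also have "\<dots> \<le> real q ^ Suc (Suc t) * real q ^ Suc t"
      using q_number_less[of "Suc t"] q_number_nonneg[OF q2, of "Suc t"]
      by (intro mult_mono) (auto intro: less_imp_le)
    also have "\<dots> = Q ^ 3 * y" by (simp add: Q_def y_def power2_eq_square power3_eq_cube mult_ac)
    finally show ?thesis .
  qed
  have \<rho>: "x * y * Q ^ 4 \<le> \<rho>"
  proof -
    have "x * y * Q ^ 4 = real q ^ (Suc e + t * 2 + 4)"
      by (simp only: Q_def x_def y_def power_add power_mult)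
    also have "Suc e + t * 2 + 4 = e + 2 * t + 5" by simp
    finally show ?thesis using assms(3) by simp
  qed
  have Q4: "16 \<le> Q ^ 4" using power_mono[OF Q, of 4] by simp
  have "(Q\<^sup>2 - 1) * (g * q_number q (Suc (Suc e)) ^ 2)
      \<le> (Q ^ 3 * y) * (z * ((Q + 1 / 3) * (Q * x)))"
  proof -
    have "(Q\<^sup>2 - 1) * (g * q_number q (Suc (Suc e)) ^ 2)
        = (g * (Q\<^sup>2 - 1)) * q_number q (Suc (Suc e)) ^ 2" by simp
    also have "\<dots> \<le> (Q ^ 3 * y) * (z * ((Q + 1 / 3) * (Q * x)))"
      by (rule mult_mono[OF g])
        (use q_number_square_le[OF assms(1)] Q y in \<open>auto simp: z_def Q_def x_def\<close>)
    finally show ?thesis .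
  qed
  also have "\<dots> = z * (x * y * Q ^ 4) * (Q + 1 / 3)"
    by (simp add: numeral_eq_Suc mult_ac)
  \<comment> \<open>The factor \<open>127 / 128\<close> pays for the term \<open>x / 2\<close> of
    the threshold: as \<open>y * Q^4 \<ge> 64\<close>, that term is at most \<open>1 / 128\<close>
    of \<open>x * y * Q^4\<close>.\<close>
  also have "\<dots> < z * (x * y * Q ^ 4) * ((Q\<^sup>2 - 1) * (127 / 128))"
  proof -
    have "0 \<le> (Q - 2) * (2 * Q + 1)" using Q by simp
    then have "3 * Q \<le> 2 * (Q\<^sup>2 - 1)" by (simp add: power2_eq_square algebra_simps)
    then have "Q + 1 / 3 < (Q\<^sup>2 - 1) * (127 / 128)" using Q by simp
    moreover have "0 < z * (x * y * Q ^ 4)" using x y z Q by (intro mult_pos_pos) auto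
    ultimately show ?thesis by (intro mult_strict_left_mono) auto
  qed
  also have "\<dots> = (Q\<^sup>2 - 1) * (z * ((x * y * Q ^ 4) * (127 / 128)))" by simp
  also have "\<dots> \<le> (Q\<^sup>2 - 1) * (z * (\<rho> - x / 2))"
  proof -
    have "x * 64 \<le> x * (y * Q ^ 4)" using mult_mono[of 4 y 16 "Q ^ 4"] y Q4 x by simp
    then have "(x * y * Q ^ 4) * (127 / 128) \<le> \<rho> - x / 2" using \<rho> by (simp add: mult.assoc)
    then show ?thesis using z Q power_mono[OF Q, of 2] by (intro mult_left_mono) auto
  qed
  finally have "g * q_number q (Suc (Suc e)) ^ 2 < z * (\<rho> - x / 2)"
    using power_mono[OF Q, of 2] by simp
  then show ?thesis using bound_ge[of e \<rho>] by (simp add: g_def z_def x_def)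
qed

text \<open>For \<open>t = 1\<close>, \<open>w\<close> will be
  \<open>num_above 4 / num_above 3\<close>. Two of the three factors become powers of
  \<open>q\<close>, and most of these are absorbed by \<open>w\<close>.\<close>

lemma q_number_cube_le:
  assumes "0 < e" "0 \<le> w" "real q ^ (e + 5) * w \<le> 1"
  shows "real q ^ 2 * (q_number q (Suc (Suc e)) ^ 3 * w)
    \<le> q_number q (Suc e) * real q ^ Suc e * (real q + 1 / 3)"
proof -
  define x where "x = real q ^ Suc e"
  have "q_number q (Suc (Suc e)) ^ 3
      \<le> q_number q (Suc e) * ((real q + 1 / 3) * (real q * x)) * (real q * x)"
  proof -
    have "q_number q (Suc (Suc e)) ^ 3 = q_number q (Suc (Suc e)) ^ 2 * q_number q (Suc (Suc e))"
      by (simp add: power3_eq_cube power2_eq_square)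
    also have "\<dots> \<le> q_number q (Suc e) * ((real q + 1 / 3) * (real q * x)) * (real q * x)"
      using q_number_square_le[OF assms(1)] q_number_less[of "Suc (Suc e)"] q_number_nonneg[OF q2]
      by (intro mult_mono) (auto simp: x_def)
    finally show ?thesis .
  qed
  then have "real q ^ 2 * (q_number q (Suc (Suc e)) ^ 3 * w)
      \<le> real q ^ 2 * (q_number q (Suc e) * ((real q + 1 / 3) * (real q * x)) * (real q * x) * w)"
    using assms(2) by (intro mult_left_mono mult_right_mono) auto
  also have "\<dots> = (q_number q (Suc e) * x * (real q + 1 / 3)) * (real q ^ (e + 5) * w)"
    by (simp add: x_def numeral_eq_Suc mult_ac)
  also have "\<dots> \<le> (q_number q (Suc e) * x * (real q + 1 / 3)) * 1"
    using assms(3) q_number_nonneg[OF q2] by (intro mult_left_mono) (auto simp: x_def)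
  finally show ?thesis by (simp add: x_def)
qed

text \<open>For \<open>t = 1\<close> and smallest covers of dimension at least 4. The left side is
  the resulting bound divided by \<open>num_above 3\<close>, with \<open>q_number q 4\<close> for
  the points of a 4-space.\<close>

lemma chain_bound_less_1:
  assumes "0 < e" "0 \<le> w" "real q ^ (e + 5) * w \<le> 1" "real q ^ (e + 5) \<le> \<rho>"
  shows "q_number q 4 * (q_number q (Suc (Suc e)) ^ 3 * w)
    < q_number q (Suc e) * \<rho> - real q * (q_number q (Suc e) * q_number q e / (real q + 1))"
proof -
  define Q x z where "Q = real q" and "x = real q ^ Suc e" and "z = q_number q (Suc e)"
  have Q: "2 \<le> Q" using q2 by (simp add: Q_def)
  have x: "0 < x" and z: "0 < z" using q2 q_number_pos[OF q2] by (simp_all add: x_def z_def)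
  have "q_number q 4 * (q_number q (Suc (Suc e)) ^ 3 * w)
      \<le> Q ^ 4 * (q_number q (Suc (Suc e)) ^ 3 * w)"
    using q_number_less[of 4] q_number_nonneg[OF q2] assms(2)
    by (intro mult_right_mono) (auto simp: Q_def)
  also have "\<dots> = Q\<^sup>2 * (Q\<^sup>2 * (q_number q (Suc (Suc e)) ^ 3 * w))"
    by (simp add: numeral_eq_Suc mult_ac)
  also have "\<dots> \<le> Q\<^sup>2 * (z * x * (Q + 1 / 3))"
    using q_number_cube_le[OF assms(1-3)] by (intro mult_left_mono) (auto simp: Q_def x_def z_def)
  also have "\<dots> = (z * x) * (Q\<^sup>2 * (Q + 1 / 3))" by (simp add: mult_ac)
  also have "\<dots> < (z * x) * (Q ^ 4 - 1 / 2)"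
  proof (rule mult_strict_left_mono)
    have "Q\<^sup>2 * (Q + 1 / 3) \<le> Q\<^sup>2 * (Q\<^sup>2 - 1)"
    proof (rule mult_left_mono)
      show "Q + 1 / 3 \<le> Q\<^sup>2 - 1" using mult_right_mono[OF Q, of Q] Q
        unfolding power2_eq_square by linarith
    qed simp
    then show "Q\<^sup>2 * (Q + 1 / 3) < Q ^ 4 - 1 / 2"
      using power_mono[OF Q, of 2] by (simp add: algebra_simps power2_eq_square numeral_eq_Suc)
    show "0 < z * x" using x z by simp
  qed
  also have "\<dots> \<le> z * (\<rho> - x / 2)"
  proof -
    have "x * Q ^ 4 = real q ^ (e + 5)" by (simp add: x_def Q_def numeral_eq_Suc mult_ac)
    then show ?thesis using assms(4) z by (simp add: mult.assoc algebra_simps)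
  qed
  finally show ?thesis using bound_ge[of e \<rho>] by (simp add: z_def x_def)
qed

text \<open>For \<open>t = 1\<close> and a point common to all 3-dimensional covers: the first term
  stands for the members through it, the second for those through one of the other points of a fixed
  cover.\<close>

lemma common_point_bound_less:
  assumes "0 < e" "0 \<le> w" "real q ^ (e + 5) * w \<le> 1" "real q ^ (e + 5) \<le> \<rho>"
  shows "q_number q (Suc (Suc e)) ^ 2 + (q_number q 3 - 1) * (q_number q (Suc (Suc e)) ^ 3 * w)
    < q_number q (Suc e) * \<rho> - real q * (q_number q (Suc e) * q_number q e / (real q + 1))"
proof -
  define Q x z where "Q = real q" and "x = real q ^ Suc e" and "z = q_number q (Suc e)"
  have Q: "2 \<le> Q" using q2 by (simp add: Q_def)
  have x: "0 < x" and z: "0 < z" using q2 q_number_pos[OF q2] by (simp_all add: x_def z_def)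
  have b3: "q_number q 3 - 1 \<le> 2 * Q\<^sup>2"
    using Q mult_right_mono[OF Q, of Q]
    by (simp add: numeral_3_eq_3 q_number_Suc Q_def power2_eq_square algebra_simps)
  have "(q_number q 3 - 1) * (q_number q (Suc (Suc e)) ^ 3 * w)
      \<le> 2 * Q\<^sup>2 * (q_number q (Suc (Suc e)) ^ 3 * w)"
    using b3 q_number_nonneg[OF q2] assms(2) by (intro mult_right_mono) auto
  also have "\<dots> \<le> 2 * (z * x * (Q + 1 / 3))"
    using q_number_cube_le[OF assms(1-3)] by (simp add: Q_def x_def z_def)
  finally have "q_number q (Suc (Suc e)) ^ 2 + (q_number q 3 - 1) * (q_number q (Suc (Suc e)) ^ 3 * w)
      \<le> (z * x) * ((Q + 2) * (Q + 1 / 3))"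
    using q_number_square_le[OF assms(1)] by (simp add: Q_def x_def z_def algebra_simps)
  also have "\<dots> < (z * x) * (Q ^ 4 - 1 / 2)"
  proof (rule mult_strict_left_mono)
    have "4 * (Q * Q) \<le> (Q * Q) * (Q * Q)" using mult_mono[OF Q Q] Q by (intro mult_right_mono) auto
    moreover have "2 * Q \<le> Q * Q" using Q by (intro mult_right_mono) auto
    moreover have "Q ^ 4 = (Q * Q) * (Q * Q)" by (simp add: numeral_eq_Suc)
    moreover have "(Q + 2) * (Q + 1 / 3) = Q * Q + 7 / 3 * Q + 2 / 3" by (simp add: field_simps)
    ultimately show "(Q + 2) * (Q + 1 / 3) < Q ^ 4 - 1 / 2"
      using Q by linarith
    show "0 < z * x" using x z by simp
  qed
  also have "\<dots> \<le> z * (\<rho> - x / 2)"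
  proof -
    have "x * Q ^ 4 = real q ^ (e + 5)" by (simp add: x_def Q_def numeral_eq_Suc mult_ac)
    then show ?thesis using assms(4) z by (simp add: mult.assoc algebra_simps)
  qed
  finally show ?thesis using bound_ge[of e \<rho>] by (simp add: z_def x_def)
qed

lemma no_common_point_bound_less:
  assumes "0 < e" "\<rho> * q_number q e = q_number q m" "2 * e + 5 \<le> m" "real q ^ (e + 5) \<le> \<rho>"
  shows "q_number q 3 ^ 2 * q_number q (Suc (Suc e))
    < q_number q (Suc e) * \<rho> - real q * (q_number q (Suc e) * q_number q e / (real q + 1))"
proof -
  define Q u where "Q = real q" and "u = real q - 2"
  have Q: "2 \<le> Q" using q2 by (simp add: Q_def)
  have u: "0 \<le> u" "Q = u + 2" using q2 by (simp_all add: Q_def u_def)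
  have b3: "q_number q 3 = Q\<^sup>2 + Q + 1"
    by (simp add: numeral_3_eq_3 q_number_Suc Q_def power2_eq_square algebra_simps)
  \<comment> \<open>For \<open>e = 1\<close> the bound \<open>q^(e+5) \<le> \<rho>\<close> is too
    weak: with \<open>q = 2\<close> the left side is 343, while \<open>\<rho> = 64\<close> gives 190
    on the right. The exact relation yields \<open>\<rho> \<ge> q_number q 7 = 127\<close>, and then
    the right side is at least 379.\<close>
  show ?thesis
  proof (cases "e = 1")
    case True
    have "q_number q 7 \<le> \<rho>" using assms(2,3) q_number_mono[of 7 m] True by (simp add: q_number_Suc)
    then have "(Q + 1) * q_number q 7 \<le> (Q + 1) * \<rho>" using Q by (intro mult_left_mono) auto
    moreover have "(Q\<^sup>2 + Q + 1) ^ 2 * (Q\<^sup>2 + Q + 1) + Q < (Q + 1) * q_number q 7"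
    proof -
      have "q_number q 7 = Q ^ 6 + Q ^ 5 + Q ^ 4 + Q ^ 3 + Q\<^sup>2 + Q + 1"
        by (simp add: numeral_eq_Suc q_number_Suc Q_def algebra_simps)
      \<comment> \<open>Expanded in powers of \<open>u = q - 2\<close>, this polynomial has only
        nonnegative coefficients and a positive constant term.\<close>
      moreover have "0 < Q ^ 7 + Q ^ 6 - Q ^ 5 - 4 * Q ^ 4 - 5 * Q ^ 3 - 4 * Q\<^sup>2 - 2 * Q"
        unfolding u(2) using u(1)
        by (simp add: numeral_eq_Suc algebra_simps) (auto intro!: add_pos_nonneg)
      ultimately show ?thesis by (simp add: numeral_eq_Suc algebra_simps)
    qed
    moreover have "q_number q (Suc e) = Q + 1" "q_number q e = 1" "q_number q (Suc (Suc e)) = Q\<^sup>2 + Q + 1"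
      using True by (simp_all add: q_number_Suc Q_def power2_eq_square algebra_simps)
    moreover have "Q * ((Q + 1) * 1 / (Q + 1)) = Q" using Q by simp
    ultimately show ?thesis unfolding b3 Q_def[symmetric] by (simp only:)
  next
    case False
    define z x where "z = q_number q (Suc e)" and "x = real q ^ Suc e"
    have z: "7 \<le> z"
    proof -
      have "q_number q 3 \<le> z" unfolding z_def using assms(1) False by (intro q_number_mono) simp
      moreover have "2 * 2 \<le> Q * Q" using Q by (intro mult_mono) auto
      ultimately show ?thesis using b3 Q by (simp add: power2_eq_square)
    qed
    have x: "Q ^ 3 \<le> x" unfolding Q_def x_def using assms(1) False q2 by (intro power_increasing) auto
    have "q_number q (Suc (Suc e)) \<le> (Q + 1 / 7) * z"
      using q_number_Suc[of "Suc e"] z by (simp add: z_def Q_def algebra_simps)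
    then have "q_number q 3 ^ 2 * q_number q (Suc (Suc e)) \<le> (Q\<^sup>2 + Q + 1) ^ 2 * ((Q + 1 / 7) * z)"
      unfolding b3 by (intro mult_left_mono) auto
    also have "\<dots> < z * (Q ^ 3 * (Q ^ 4 - 1 / 2))"
    proof -
      have "0 < Q ^ 3 * (Q ^ 4 - 1 / 2) - (Q\<^sup>2 + Q + 1) ^ 2 * (Q + 1 / 7)"
        unfolding u(2) using u(1)
        by (simp add: numeral_eq_Suc algebra_simps) (auto intro!: add_pos_nonneg)
      then have "(Q\<^sup>2 + Q + 1) ^ 2 * (Q + 1 / 7) < Q ^ 3 * (Q ^ 4 - 1 / 2)" by simp
      from mult_strict_left_mono[OF this, of z] z show ?thesis by (simp add: mult_ac)
    qed
    also have "\<dots> \<le> z * (x * (Q ^ 4 - 1 / 2))"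
      using x z power_mono[OF Q, of 4] by (intro mult_left_mono mult_right_mono) auto
    also have "\<dots> \<le> z * (\<rho> - x / 2)"
    proof -
      have "x * Q ^ 4 = real q ^ (e + 5)" by (simp add: x_def Q_def numeral_eq_Suc mult_ac)
      then show ?thesis using assms(4) z by (simp add: algebra_simps)
    qed
    finally show ?thesis using bound_ge[of e \<rho>] by (simp add: z_def x_def)
  qed
qed

end

section \<open>Counting subspaces over a finite field\<close>

lemma double_count:
  fixes G :: "'a set set"
  assumes "finite G" "finite A"
    and "\<And>F. F \<in> G \<Longrightarrow> c \<le> real (card (F \<inter> A))"
    and "\<And>v. v \<in> A \<Longrightarrow> real (card {F \<in> G. v \<in> F}) \<le> B"
  shows "real (card G) * c \<le> real (card A) * B"
proof -
  have 1: "card {F \<in> G. v \<in> F} = (\<Sum>F\<in>G. if v \<in> F then 1 else 0)" for v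
    using assms(1) by (simp add: sum.If_cases Int_def)
  have 2: "card (F \<inter> A) = (\<Sum>v\<in>A. if v \<in> F then 1 else 0)" for F
    using assms(2) by (simp add: sum.If_cases Int_def conj_commute)
  have "real (card G) * c \<le> (\<Sum>F\<in>G. real (card (F \<inter> A)))"
    using assms(3) sum_mono[of G "\<lambda>_. c" "\<lambda>F. real (card (F \<inter> A))"] by simp
  also have "\<dots> = (\<Sum>v\<in>A. real (card {F \<in> G. v \<in> F}))"
    unfolding 1 2 of_nat_sum by (rule sum.swap)
  also have "\<dots> \<le> real (card A) * B"
    using assms(4) sum_bounded_above[of A "\<lambda>v. real (card {F \<in> G. v \<in> F})" B] by simp
  finally show ?thesis .
qed

lemma card_le_UN:
  assumes "finite I" "finite A" "A \<subseteq> (\<Union>i\<in>I. B i)" "\<And>i. i \<in> I \<Longrightarrow> real (card (A \<inter> B i)) \<le> b"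
  shows "real (card A) \<le> real (card I) * b"
proof -
  have "A = (\<Union>i\<in>I. A \<inter> B i)" using assms(3) by blast
  then have "card A \<le> (\<Sum>i\<in>I. card (A \<inter> B i))"
    using card_UN_le[OF assms(1), of "\<lambda>i. A \<inter> B i"] by metis
  then have "real (card A) \<le> (\<Sum>i\<in>I. real (card (A \<inter> B i)))"
    by (metis of_nat_le_iff of_nat_sum)
  also have "\<dots> \<le> real (card I) * b"
    using assms(4) sum_bounded_above[of I "\<lambda>i. real (card (A \<inter> B i))" b] by simp
  finally show ?thesis .
qed

locale finite_field_space = finite_dimensional_vector_space scale Basis
  for scale :: "'f::{field,finite} \<Rightarrow> 'v::ab_group_add \<Rightarrow> 'v" and Basis +
  fixes q :: nat
  assumes q_eq_card: "q = CARD('f)"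
begin

lemma card_span_insert:
  assumes "subspace S" "v \<notin> S"
  shows "card (span (insert v S)) = q * card S"
proof -
  let ?g = "\<lambda>(c, x). scale c v + x"
  have "inj_on ?g (UNIV \<times> S)"
  proof (rule inj_onI, clarsimp)
    fix c x d y
    assume xy: "x \<in> S" "y \<in> S" and eq: "scale c v + x = scale d v + y"
    have "scale (c - d) v = y - x"
      using eq by (simp add: scale_left_diff_distrib algebra_simps)
    then have mem: "scale (c - d) v \<in> S"
      using assms(1) xy subspace_diff by simp
    have "c = d"
    proof (rule ccontr)
      assume "c \<noteq> d"
      then have "v = scale (inverse (c - d)) (scale (c - d) v)" by simp
      then show False using mem assms subspace_scale by metis
    qed
    then show "c = d \<and> x = y" using eq by simp
  qed
  moreover have "?g ` (UNIV \<times> S) = span (insert v S)"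
  proof (intro set_eqI iffI)
    fix x assume "x \<in> ?g ` (UNIV \<times> S)"
    then obtain c y where x: "x = scale c v + y" and y: "y \<in> S" by auto
    show "x \<in> span (insert v S)"
      unfolding x using y by (intro span_add span_scale span_base) auto
  next
    fix x assume "x \<in> span (insert v S)"
    then obtain c where "x - scale c v \<in> span S" by (auto simp: span_breakdown_eq)
    then have "x - scale c v \<in> S" using assms(1) by (simp add: span_eq_iff[THEN iffD2])
    then show "x \<in> ?g ` (UNIV \<times> S)"
      by (intro image_eqI[of _ _ "(c, x - scale c v)"]) auto
  qed
  ultimately show ?thesis
    unfolding q_eq_card by (metis card_image card_cartesian_product)
qed

lemma card_subspace:
  assumes "subspace S"
  shows "card S = q ^ dim S"
proof -
  have *: "card (span B) = q ^ card B" if "finite B" "independent B" for B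
    using that
  proof (induction B)
    case (insert v B)
    then have "v \<notin> span B" "independent B" by (simp_all add: independent_insert)
    then show ?case
      using card_span_insert[of "span B" v] insert by (simp add: insert_commute span_insert)
        (metis span_insert span_span)
  qed simp
  obtain B where "B \<subseteq> S" "independent B" "S \<subseteq> span B" "card B = dim S"
    using basis_exists by metis
  then show ?thesis using *[of B] finiteI_independent assms
    by (metis span_subspace)
qed

lemma q_ge_2: "2 \<le> q"
proof -
  have "card {0, 1::'f} \<le> CARD('f)" by (intro card_mono) auto
  then show ?thesis by (simp add: q_eq_card)
qed

lemma finite_UNIV_space: "finite (UNIV :: 'v set)"
proof -
  have "card (UNIV :: 'v set) > 0"
    using card_subspace[OF subspace_UNIV] q_ge_2 by simp
  then show ?thesis by (simp add: card_gt_0_iff)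
qed

lemma finite_vectors [simp]: "finite (A :: 'v set)"
  using finite_UNIV_space by (rule rev_finite_subset) simp

lemma finite_families [simp]: "finite (A :: 'v set set)"
  by (rule finite_subset[of _ "Pow UNIV"]) (use finite_UNIV_space in \<open>simp_all add: Finite_Set.finite_set\<close>)

lemma dim_span_insert: "subspace S \<Longrightarrow> v \<notin> S \<Longrightarrow> dim (span (insert v S)) = Suc (dim S)"
  by (simp add: dim_insert span_eq_iff[THEN iffD2])

lemma dim_sum_Int:
  assumes "subspace S" "subspace T"
  shows "dim (span (S \<union> T)) + dim (S \<inter> T) = dim S + dim T"
proof -
  have "span (S \<union> T) = {x + y |x y. x \<in> S \<and> y \<in> T}"
    using assms by (simp add: span_Un span_eq_iff[THEN iffD2])
  then show ?thesis using dim_sums_Int[OF assms] by simp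
qed

lemma intermediate_subspace:
  assumes "subspace A" "subspace B" "A \<subseteq> B" "dim A \<le> d" "d \<le> dim B"
  obtains D where "subspace D" "A \<subseteq> D" "D \<subseteq> B" "dim D = d"
proof -
  have "\<exists>D. subspace D \<and> A \<subseteq> D \<and> D \<subseteq> B \<and> dim D = d"
    using assms(4,5)
  proof (induction d rule: dec_induct)
    case base
    then show ?case using assms by blast
  next
    case (step d)
    then obtain D where D: "subspace D" "A \<subseteq> D" "D \<subseteq> B" "dim D = d" by auto
    have "\<not> B \<subseteq> D" using D step.prems dim_subset[of B D] by auto
    then obtain v where v: "v \<in> B" "v \<notin> D" by blast
    have "span (insert v D) \<subseteq> B" using v D assms by (intro span_minimal) auto
    moreover have "A \<subseteq> span (insert v D)" using D span_superset by blast
    ultimately show ?case using dim_span_insert[OF D(1) v(2)] D(4) subspace_span by metis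
  qed
  then show ?thesis using that by blast
qed

text \<open>Adding to \<open>F\<close> a vector outside \<open>F + U\<close> leaves
  \<open>F \<inter> U\<close> unchanged, and such a vector exists while \<open>F + U\<close> is not
  the whole space. The last assumption guarantees this until dimension \<open>d\<close> is
  reached.\<close>

lemma extend_avoiding:
  assumes "subspace T" "subspace U" "dim T \<le> d" "d + dim U \<le> dim (UNIV::'v set) + dim (T \<inter> U)"
  obtains F where "subspace F" "T \<subseteq> F" "dim F = d" "F \<inter> U = T \<inter> U"
proof -
  have "\<exists>F. subspace F \<and> T \<subseteq> F \<and> dim F = d \<and> F \<inter> U = T \<inter> U"
    using assms(3,4)
  proof (induction d rule: dec_induct)
    case base
    then show ?case using assms by blast
  next
    case (step d)
    then obtain F where F: "subspace F" "T \<subseteq> F" "dim F = d" "F \<inter> U = T \<inter> U" by auto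
    have "dim (span (F \<union> U)) < dim (UNIV::'v set)"
      using dim_sum_Int[OF F(1) assms(2)] F step.prems by simp
    then obtain v where v: "v \<notin> span (F \<union> U)" by (metis UNIV_eq_I less_irrefl)
    then have "v \<notin> F" using span_superset by blast
    then have "dim (span (insert v F)) = Suc d" using F dim_span_insert by simp
    moreover have "span (insert v F) \<inter> U \<subseteq> F"
    proof
      fix x assume x: "x \<in> span (insert v F) \<inter> U"
      then obtain c where c: "x - scale c v \<in> F"
        using F(1) by (auto simp: span_breakdown_eq span_eq_iff[THEN iffD2])
      have "scale c v \<in> span (F \<union> U)"
      proof -
        have "x - (x - scale c v) \<in> span (F \<union> U)"
          using x c by (intro span_diff span_base) auto
        then show ?thesis by simp
      qed
      then have "c = 0"
        using v span_scale[of "scale c v" "F \<union> U" "inverse c"] by (cases "c = 0") auto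
      then show "x \<in> F" using c by simp
    qed
    moreover have "F \<subseteq> span (insert v F)" using span_superset by blast
    ultimately show ?case using F subspace_span
      by (intro exI[of _ "span (insert v F)"]) blast
  qed
  then show ?thesis using that by blast
qed

lemma subspace_eqI: "subspace S \<Longrightarrow> subspace T \<Longrightarrow> S \<subseteq> T \<Longrightarrow> dim T \<le> dim S \<Longrightarrow> S = T"
  by (rule subspace_dim_equal)

lemma q_gt_1: "1 < real q"
  using q_ge_2 by simp

lemma card_Diff_subspaces:
  assumes "subspace A" "subspace B"
  shows "real (card (A - B)) = real q ^ dim A - real q ^ dim (A \<inter> B)"
proof -
  have "card (A - B) = card A - card (A \<inter> B)" by (rule card_Diff_subset_Int) simp
  moreover have "card (A \<inter> B) \<le> card A" by (intro card_mono) auto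
  ultimately show ?thesis
    using card_subspace[OF assms(1)] card_subspace[OF subspace_inter[OF assms]] by simp
qed

text \<open>Counts incidences between members of \<open>G\<close> and vectors of
  \<open>W - U\<close>: each member contains at least \<open>q^(r+1) - q^r\<close> of these
  vectors.\<close>

lemma branching:
  assumes "\<And>F. F \<in> G \<Longrightarrow> subspace F" "subspace W" "subspace U"
    and "\<And>F. F \<in> G \<Longrightarrow> r < dim (F \<inter> W)" "\<And>F. F \<in> G \<Longrightarrow> dim (F \<inter> W \<inter> U) \<le> r"
    and "\<And>v. v \<in> W \<Longrightarrow> v \<notin> U \<Longrightarrow> real (card {F \<in> G. v \<in> F}) \<le> B"
  shows "real (card G) * (real q ^ r * (real q - 1)) \<le>
    (real q ^ dim W - real q ^ dim (W \<inter> U)) * B"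
proof -
  have "real (card G) * (real q ^ r * (real q - 1)) \<le> real (card (W - U)) * B"
  proof (rule double_count)
    fix F assume F: "F \<in> G"
    have "real q ^ r * (real q - 1) = real q ^ Suc r - real q ^ r"
      by (simp add: algebra_simps)
    also have "\<dots> \<le> real q ^ dim (F \<inter> W) - real q ^ dim (F \<inter> W \<inter> U)"
      using assms(4,5)[OF F] q_gt_1 by (intro diff_mono power_increasing) auto
    also have "\<dots> = real (card (F \<inter> (W - U)))"
      using card_Diff_subspaces[OF subspace_inter[OF assms(1)[OF F] assms(2)] assms(3)]
      by (simp add: Int_Diff)
    finally show "real q ^ r * (real q - 1) \<le> real (card (F \<inter> (W - U)))" .
  qed (use assms in auto)
  then show ?thesis using card_Diff_subspaces assms by simp
qed

text \<open>Counts the pairs of a subspace and a vector of \<open>Z - S\<close> in it. Fixing the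
  vector \<open>v\<close> replaces \<open>S\<close> by \<open>span (insert v S)\<close>, which
  drives the induction on \<open>d - dim S\<close>.\<close>

lemma card_subspaces_between:
  assumes "subspace S" "subspace Z" "S \<subseteq> Z" "d \<le> dim Z"
  shows "real (card {F. subspace F \<and> S \<subseteq> F \<and> F \<subseteq> Z \<and> dim F = d})
    \<le> gauss_binomial q (int (dim Z) - int (dim S)) (int d - int (dim S))"
proof (cases "dim S \<le> d")
  case False
  then have "{F. subspace F \<and> S \<subseteq> F \<and> F \<subseteq> Z \<and> dim F = d} = {}"
    using dim_subset by fastforce
  then show ?thesis using False by simp
next
  case True
  then show ?thesis using assms(1,3)
  proof (induction "d - dim S" arbitrary: S)
    case 0
    then have "{F. subspace F \<and> S \<subseteq> F \<and> F \<subseteq> Z \<and> dim F = d} \<subseteq> {S}"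
      using subspace_eqI by fastforce
    from card_mono[OF _ this] show ?case using 0 by simp
  next
    case (Suc j)
    let ?G = "\<lambda>S. {F. subspace F \<and> S \<subseteq> F \<and> F \<subseteq> Z \<and> dim F = d}"
    let ?B = "gauss_binomial q (int (dim Z) - int (dim S) - 1) (int d - int (dim S) - 1)"
    have *: "real (card (?G S)) * (real q ^ d - real q ^ dim S) \<le> real (card (Z - S)) * ?B"
    proof (rule double_count)
      fix F assume "F \<in> ?G S"
      then show "real q ^ d - real q ^ dim S \<le> real (card (F \<inter> (Z - S)))"
        using card_Diff_subspaces[of F S] Suc.prems
        by (auto simp: Int_absorb1 Int_absorb2 Int_Diff[symmetric])
    next
      fix v assume v: "v \<in> Z - S"
      have eq: "{F \<in> ?G S. v \<in> F} = ?G (span (insert v S))"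
        using span_superset[of "insert v S"] by (auto dest: span_minimal[of "insert v S", rotated])
      have "real (card (?G (span (insert v S))))
        \<le> gauss_binomial q (int (dim Z) - int (dim (span (insert v S))))
             (int d - int (dim (span (insert v S))))"
      proof (rule Suc.hyps)
        have "insert v S \<subseteq> Z" using v Suc.prems by blast
        then show "span (insert v S) \<subseteq> Z" using assms(2) by (rule span_minimal)
      qed (use Suc.hyps(2) v dim_span_insert[OF Suc.prems(2)] in auto)
      then show "real (card {F \<in> ?G S. v \<in> F}) \<le> ?B"
        unfolding eq using dim_span_insert[of S v] v Suc.prems by (simp add: algebra_simps)
    qed simp_all
    have le: "dim S < d" "dim S < dim Z" using Suc assms(4) by auto
    have pw: "real q ^ e - real q ^ dim S = real q ^ dim S * (real q powi (int e - int (dim S)) - 1)"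
      if "dim S < e" for e
      using that q_gt_1 by (simp add: power_int_diff power_int_of_nat right_diff_distrib)
    have "real (card (?G S)) * (real q powi (int d - int (dim S)) - 1)
        \<le> (real q powi (int (dim Z) - int (dim S)) - 1) * ?B"
    proof -
      have "Z \<inter> S = S" using Suc.prems by blast
      then have "real (card (Z - S)) = real q ^ dim Z - real q ^ dim S"
        using card_Diff_subspaces[OF assms(2) Suc.prems(2)] by simp
      then have "real q ^ dim S * (real (card (?G S)) * (real q powi (int d - int (dim S)) - 1))
          \<le> real q ^ dim S * ((real q powi (int (dim Z) - int (dim S)) - 1) * ?B)"
        using * unfolding pw[OF le(1)] pw[OF le(2)] by (simp only: mult_ac)
      then show ?thesis using q_gt_1 by (simp only: mult_le_cancel_left_pos zero_less_power)
    qed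
    moreover have "real q powi (int d - int (dim S)) - 1 > 0"
    proof -
      have "real q ^ (d - dim S) > 1" using le q_gt_1 by (intro one_less_power) auto
      then show ?thesis using le by (simp add: power_int_def nat_diff_distrib)
    qed
    ultimately have "real (card (?G S)) \<le> (real q powi (int (dim Z) - int (dim S)) - 1) * ?B
        / (real q powi (int d - int (dim S)) - 1)"
      by (simp add: pos_le_divide_eq)
    then show ?case
      using gauss_binomial_rec[of "int d - int (dim S)" q "int (dim Z) - int (dim S)"] le
      by simp
  qed
qed

text \<open>The form of \<open>branching\<close> after cancelling \<open>q^r * (q - 1)\<close>. The
  excess \<open>f\<close> of \<open>dim (W \<inter> U)\<close> over \<open>r\<close> is
  \<open>0\<close> for plain branching, \<open>1\<close> when the cover is unique, and
  \<open>j = dim M - t\<close> in the star case.\<close>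

lemma branching_card:
  assumes "\<And>F. F \<in> G \<Longrightarrow> subspace F" "subspace W" "subspace U"
    and "\<And>F. F \<in> G \<Longrightarrow> r < dim (F \<inter> W)" "\<And>F. F \<in> G \<Longrightarrow> dim (F \<inter> W \<inter> U) \<le> r"
    and "\<And>v. v \<in> W \<Longrightarrow> v \<notin> U \<Longrightarrow> real (card {F \<in> G. v \<in> F}) \<le> B"
    and "dim W = r + (f + e)" "dim (W \<inter> U) = r + f"
  shows "real (card G) \<le> real q ^ f * q_number q e * B"
proof -
  have "real (card G) * (real q ^ r * (real q - 1)) \<le>
      (real q ^ dim W - real q ^ dim (W \<inter> U)) * B"
    by (rule branching) (use assms in auto)
  then have "real q ^ r * (real (card G) * (real q - 1))
      \<le> real q ^ r * (real q ^ f * (real q ^ e - 1) * B)"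
    unfolding assms(7,8) by (simp add: power_add algebra_simps)
  then have "real (card G) * (real q - 1) \<le> real q ^ f * (real q ^ e - 1) * B"
    using q_gt_1 by (simp only: mult_le_cancel_left_pos zero_less_power)
  then have "real (card G) \<le> real q ^ f * (real q ^ e - 1) * B / (real q - 1)"
    using q_gt_1 by (simp add: pos_le_divide_eq)
  then show ?thesis by (simp add: q_number_def)
qed

lemma dim_Int_ge:
  assumes "subspace A" "subspace B" "subspace Z" "A \<subseteq> Z" "B \<subseteq> Z"
  shows "dim A + dim B \<le> dim Z + dim (A \<inter> B)"
proof -
  have "span (A \<union> B) \<subseteq> Z" using assms by (intro span_minimal) auto
  from dim_subset[OF this] show ?thesis using dim_sum_Int[OF assms(1,2)] by simp
qed

lemma dim_less:
  assumes "subspace A" "subspace B" "A \<subseteq> B" "A \<noteq> B"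
  shows "dim A < dim B"
  using subspace_eqI[OF assms(1-3)] assms(4) by linarith

end

section \<open>Covers of a maximal non-trivial family\<close>

text \<open>The bound on \<open>n\<close> is the one shared by all \<open>t > 0\<close>, because
  \<open>min 4 (2 * t)\<close> is 2 for \<open>t = 1\<close> and 4 otherwise. The full hypothesis
  enters in \<open>large_family_classification\<close>.\<close>

locale nontrivial_family = finite_field_space +
  fixes n k t :: nat and \<F> :: "'b set set"
  assumes dim_UNIV_eq: "dim UNIV = n"
    and t_pos: "0 < t" and t_less: "t + 2 \<le> k" and n_ge: "2 * k + t + 2 \<le> n"
    and maximal: "maximal_t_intersecting scale k t \<F>"
    and nontrivial: "\<not> trivial_family scale t \<F>"
begin

definition cover :: "'b set \<Rightarrow> bool" where
  "cover C \<longleftrightarrow> subspace C \<and> (\<forall>F\<in>\<F>. t \<le> dim (C \<inter> F))"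

definition above :: "'b set \<Rightarrow> 'b set set" where
  "above S = {F \<in> \<F>. S \<subseteq> F}"

text \<open>The number of \<open>k\<close>-spaces through a fixed \<open>s\<close>-space. The
  integer arguments make it \<open>0\<close> for \<open>s > k\<close>, so that
  \<open>num_above 4\<close> makes sense for \<open>k = 3\<close>.\<close>

definition num_above :: "nat \<Rightarrow> real" where
  "num_above s = gauss_binomial q (int n - int s) (int k - int s)"

lemma family_subspaces: "\<F> \<subseteq> subspaces scale k"
  and family_intersecting: "t_intersecting scale t \<F>"
  using maximal unfolding maximal_t_intersecting_def by (blast elim: conjE)+

lemma member: "F \<in> \<F> \<Longrightarrow> subspace F" "F \<in> \<F> \<Longrightarrow> dim F = k"
  using family_subspaces by (auto simp: subspaces_def)

lemma intersecting: "A \<in> \<F> \<Longrightarrow> B \<in> \<F> \<Longrightarrow> t \<le> dim (A \<inter> B)"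
  using family_intersecting by (simp add: t_intersecting_def)

lemma cover_subspace: "cover C \<Longrightarrow> subspace C"
  by (simp add: cover_def)

lemma coverD: "cover C \<Longrightarrow> F \<in> \<F> \<Longrightarrow> t \<le> dim (C \<inter> F)"
  by (simp add: cover_def)

lemma family_eqI:
  assumes "\<F> \<subseteq> G" "G \<subseteq> subspaces scale k" "t_intersecting scale t G"
  shows "\<F> = G"
  using maximal assms unfolding maximal_t_intersecting_def psubset_eq by metis

text \<open>Maximality as a membership test: otherwise \<open>insert A \<F>\<close> would be a
  larger \<open>t\<close>-intersecting family.\<close>

lemma memberI:
  assumes "subspace A" "dim A = k" "\<And>F. F \<in> \<F> \<Longrightarrow> t \<le> dim (A \<inter> F)"
  shows "A \<in> \<F>"
proof -
  have "\<F> = insert A \<F>"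
  proof (rule family_eqI)
    show "insert A \<F> \<subseteq> subspaces scale k"
      using assms(1,2) family_subspaces by (simp add: subspaces_def)
    show "t_intersecting scale t (insert A \<F>)"
      using assms t_less intersecting by (auto simp: t_intersecting_def Int_commute)
  qed blast
  then show ?thesis by blast
qed

lemma memberI_cover:
  assumes "cover C" "C \<subseteq> A" "subspace A" "dim A = k"
  shows "A \<in> \<F>"
proof (rule memberI)
  fix F assume "F \<in> \<F>"
  then have "t \<le> dim (C \<inter> F)" using assms(1) coverD by blast
  also have "\<dots> \<le> dim (A \<inter> F)" using assms(2) by (intro dim_subset) auto
  finally show "t \<le> dim (A \<inter> F)" .
qed (use assms in auto)

lemma member_cover: "F \<in> \<F> \<Longrightarrow> cover F"
  by (simp add: cover_def member intersecting)

text \<open>As \<open>n \<ge> 2 * k\<close>, the cover \<open>S\<close> extends to a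
  \<open>k\<close>-space \<open>F\<close> with \<open>F \<inter> T = S \<inter> T\<close>.
  Containing a cover, \<open>F\<close> is a member, so the cover \<open>T\<close> meets it in
  dimension at least \<open>t\<close>.\<close>

lemma cover_Int_cover:
  assumes "cover S" "cover T" "dim S \<le> k" "dim T \<le> k"
  shows "t \<le> dim (S \<inter> T)"
proof -
  have "k + dim T \<le> dim (UNIV :: 'b set) + dim (S \<inter> T)"
    using assms(4) n_ge dim_UNIV_eq by simp
  then obtain F where "subspace F" "S \<subseteq> F" "dim F = k" "F \<inter> T = S \<inter> T"
    using extend_avoiding assms cover_subspace by metis
  then show ?thesis using memberI_cover[OF assms(1)] coverD[OF assms(2)] by (metis Int_commute)
qed

lemma exists_member_avoiding:
  assumes "subspace X" "dim X = t"
  obtains F where "F \<in> \<F>" "\<not> X \<subseteq> F"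
proof -
  have "X \<in> subspaces scale t" using assms by (simp add: subspaces_def)
  then show ?thesis using nontrivial that unfolding trivial_family_def by blast
qed

lemma family_nonempty: "\<F> \<noteq> {}"
proof -
  obtain X where X: "subspace X" "dim X = t"
    using intermediate_subspace[of "{0}" UNIV t] dim_UNIV_eq n_ge by auto
  show ?thesis using exists_member_avoiding[OF X] by blast
qed

text \<open>Such a cover would have dimension exactly \<open>t\<close> and lie in every member, so
  the family would be trivial.\<close>

lemma not_cover:
  assumes "subspace X" "dim X \<le> t"
  shows "\<not> cover X"
proof
  assume X: "cover X"
  have dX: "dim X = t"
  proof -
    obtain F where F: "F \<in> \<F>" using family_nonempty by blast
    have "dim (X \<inter> F) \<le> dim X" by (intro dim_subset) auto
    then show ?thesis using coverD[OF X F] assms(2) by simp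
  qed
  obtain F where F: "F \<in> \<F>" "\<not> X \<subseteq> F" using exists_member_avoiding[OF assms(1) dX] .
  have "X \<inter> F = X"
    using assms(1) member(1)[OF F(1)] coverD[OF X F(1)] dX
    by (intro subspace_eqI) (auto intro: subspace_inter)
  then show False using F(2) by blast
qed

lemma num_above_nonneg: "s \<le> n \<Longrightarrow> num_above s \<ge> 0"
  using gauss_binomial_pos[OF q_ge_2, of "k - s" "n - s"] n_ge unfolding num_above_def
  by (cases "s \<le> k") (auto simp: of_nat_diff intro: less_imp_le)

lemma num_above_Suc:
  assumes "s < k"
  shows "num_above s = (real q ^ (n - s) - 1) / (real q ^ (k - s) - 1) * num_above (Suc s)"
proof -
  have *: "int n - int s = int (n - s)" "int k - int s = int (k - s)"
    "int n - int s - 1 = int n - int (Suc s)" "int k - int s - 1 = int k - int (Suc s)"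
    using assms n_ge by auto
  have "num_above s = (real q powi (int n - int s) - 1) / (real q powi (int k - int s) - 1) *
      gauss_binomial q (int n - int s - 1) (int k - int s - 1)"
    unfolding num_above_def by (rule gauss_binomial_rec) (use assms in simp)
  then show ?thesis
    unfolding *(3,4) num_above_def[symmetric] unfolding *(1,2) power_int_of_nat .
qed

lemma card_above:
  assumes "subspace S"
  shows "real (card (above S)) \<le> num_above (dim S)"
proof -
  have "above S \<subseteq> {F. subspace F \<and> S \<subseteq> F \<and> F \<subseteq> UNIV \<and> dim F = k}"
    by (auto simp: above_def member)
  from card_mono[OF _ this] show ?thesis
    using card_subspaces_between[OF assms, of UNIV k] dim_UNIV_eq n_ge
    by (simp add: num_above_def)
qed

text \<open>
  The dimension of \<open>W\<close> below is chosen so that every member above \<open>S\<close>, which meets \<open>F'\<close> in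
  dimension at least \<open>t\<close>, meets \<open>W\<close> outside \<open>S\<close>.
\<close>

lemma noncover_branching:
  assumes "subspace S" "\<not> cover S" "G \<subseteq> above S"
    and "\<And>v. v \<notin> S \<Longrightarrow> real (card {F \<in> G. v \<in> F}) \<le> B"
  shows "real (card G) \<le> q_number q (k + 1 - t) * B"
proof -
  obtain F' where F': "F' \<in> \<F>" "dim (S \<inter> F') < t"
    using assms(1,2) by (auto simp: cover_def not_le)
  let ?r = "dim (S \<inter> F')"
  have sub: "subspace (S \<inter> F')" and "k + 1 - t + ?r \<le> dim F'"
    using F' assms(1) member[OF F'(1)] subspace_inter t_less by auto
  then obtain W where W: "subspace W" "S \<inter> F' \<subseteq> W" "W \<subseteq> F'" "dim W = k + 1 - t + ?r"
    using intermediate_subspace[OF sub member(1)[OF F'(1)]] by (metis Int_lower2 le_add2)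
  have WS: "W \<inter> S = S \<inter> F'" using W by blast
  have dW: "dim W + t = k + 1 + ?r" using W(4) t_less by simp
  have "real (card G) \<le> real q ^ 0 * q_number q (k + 1 - t) * B"
  proof (rule branching_card)
    fix F assume "F \<in> G"
    then have F: "F \<in> \<F>" "S \<subseteq> F" using assms(3) by (auto simp: above_def)
    show "subspace F" using F member by blast
    have "dim (span (F \<inter> F' \<union> W)) \<le> k"
      using W member[OF F'(1)] dim_subset[OF span_minimal[of "F \<inter> F' \<union> W" F']] by blast
    moreover have FW: "F \<inter> F' \<inter> W = F \<inter> W" using W(3) by blast
    have "dim (span (F \<inter> F' \<union> W)) + dim (F \<inter> W) = dim (F \<inter> F') + dim W"
      using dim_sum_Int[OF subspace_inter[OF member(1)[OF F(1)] member(1)[OF F'(1)]] W(1)]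
      unfolding FW .
    moreover have "t \<le> dim (F \<inter> F')" using F F' intersecting by blast
    ultimately show "?r < dim (F \<inter> W)"
      using dW by linarith
    have "F \<inter> W \<inter> S \<subseteq> S \<inter> F'" using W(3) by blast
    then show "dim (F \<inter> W \<inter> S) \<le> ?r" by (rule dim_subset)
  next
    fix v assume "v \<notin> S"
    then show "real (card {F \<in> G. v \<in> F}) \<le> B" by (rule assms(4))
  next
    show "dim W = ?r + (0 + (k + 1 - t))" "dim (W \<inter> S) = ?r + 0" using W(4) WS by simp_all
  qed (fact W(1) assms(1))+
  then show ?thesis by simp
qed

lemma above_insert: "subspace S \<Longrightarrow> F \<in> \<F> \<Longrightarrow> span (insert v S) \<subseteq> F \<longleftrightarrow> v \<in> F \<and> S \<subseteq> F"
  by (metis insert_subset member(1) span_minimal span_superset subset_trans)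

text \<open>Iterates \<open>noncover_branching\<close>, each step raising the dimension of the
  subspace by one. A subfamily \<open>G\<close> is allowed so that members through a given point can
  be set aside beforehand.\<close>

lemma noncover_chain:
  assumes "subspace S" "G \<subseteq> \<F>" "0 \<le> B"
    and "\<And>R. subspace R \<Longrightarrow> S \<subseteq> R \<Longrightarrow> dim R < dim S + d \<Longrightarrow> \<not> cover R"
    and "\<And>R. subspace R \<Longrightarrow> S \<subseteq> R \<Longrightarrow> dim R = dim S + d \<Longrightarrow> real (card (G \<inter> above R)) \<le> B"
  shows "real (card (G \<inter> above S)) \<le> q_number q (k + 1 - t) ^ d * B"
  using assms(1,4,5)
proof (induction d arbitrary: S)
  case 0
  then show ?case by simp
next
  case (Suc d)
  have "real (card (G \<inter> above S)) \<le> q_number q (k + 1 - t) * (q_number q (k + 1 - t) ^ d * B)"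
  proof (rule noncover_branching)
    fix v assume v: "v \<notin> S"
    let ?R = "span (insert v S)"
    have R: "S \<subseteq> ?R" "dim ?R = Suc (dim S)"
      using span_superset dim_span_insert[OF Suc.prems(1) v] by blast+
    have "{F \<in> G \<inter> above S. v \<in> F} = G \<inter> above ?R"
      using above_insert[OF Suc.prems(1)] assms(2) by (auto simp: above_def)
    moreover have "real (card (G \<inter> above ?R)) \<le> q_number q (k + 1 - t) ^ d * B"
      using R by (intro Suc.IH Suc.prems) auto
    ultimately show "real (card {F \<in> G \<inter> above S. v \<in> F}) \<le> q_number q (k + 1 - t) ^ d * B"
      by simp
  qed (use Suc.prems in auto)
  then show ?case by (simp add: mult.assoc)
qed

lemma above_chain:
  assumes "subspace S" "dim S \<le> m" "m \<le> n"
    and "\<And>R. subspace R \<Longrightarrow> S \<subseteq> R \<Longrightarrow> dim R < m \<Longrightarrow> \<not> cover R"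
  shows "real (card (above S)) \<le> q_number q (k + 1 - t) ^ (m - dim S) * num_above m"
proof -
  have "real (card (\<F> \<inter> above S)) \<le> q_number q (k + 1 - t) ^ (m - dim S) * num_above m"
  proof (rule noncover_chain)
    fix R assume "subspace R" "S \<subseteq> R" "dim R = dim S + (m - dim S)"
    then show "real (card (\<F> \<inter> above R)) \<le> num_above m"
      using card_above[of R] assms(2) by (auto simp: above_def Int_def)
  qed (use assms num_above_nonneg in auto)
  then show ?thesis by (simp add: above_def Int_def)
qed

text \<open>The conjunct \<open>{0} \<subseteq> S\<close> gives the index set the shape counted by
  \<open>card_subspaces_between\<close>.\<close>

lemma cover_subset_UN:
  assumes "cover T"
  shows "\<F> \<subseteq> (\<Union>S\<in>{S. subspace S \<and> {0} \<subseteq> S \<and> S \<subseteq> T \<and> dim S = t}. above S)"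
proof
  fix F assume F: "F \<in> \<F>"
  have sub: "subspace (T \<inter> F)"
    using F assms cover_subspace member(1) subspace_inter by blast
  obtain S where "subspace S" "{0} \<subseteq> S" "S \<subseteq> T \<inter> F" "dim S = t"
    using intermediate_subspace[OF subspace_single_0 sub, of t] subspace_0[OF sub]
      coverD[OF assms F] by auto
  then show "F \<in> (\<Union>S\<in>{S. subspace S \<and> {0} \<subseteq> S \<and> S \<subseteq> T \<and> dim S = t}. above S)"
    using F by (auto simp: above_def)
qed

lemma card_subspaces_of:
  assumes "subspace T" "t \<le> dim T"
  shows "real (card {S. subspace S \<and> {0} \<subseteq> S \<and> S \<subseteq> T \<and> dim S = t})
    \<le> gauss_binomial q (int (dim T)) (int t)"
  using card_subspaces_between[of "{0}" T t] assms subspace_0[OF assms(1)] by simp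

text \<open>Each member contains a \<open>t\<close>-space of \<open>T\<close>; from there the chain
  climbs to dimension \<open>dim T\<close>, below which no subspace is a cover.\<close>

lemma card_family_le_chain:
  assumes "cover T" "dim T \<le> n" and "\<And>R. subspace R \<Longrightarrow> dim R < dim T \<Longrightarrow> \<not> cover R"
  shows "real (card \<F>) \<le> gauss_binomial q (int (dim T)) (int t) *
    (q_number q (k + 1 - t) ^ (dim T - t) * num_above (dim T))"
proof -
  have tT: "t \<le> dim T" using not_cover assms(1) cover_subspace by (metis nat_le_linear)
  have "real (card \<F>) \<le> real (card {S. subspace S \<and> {0} \<subseteq> S \<and> S \<subseteq> T \<and> dim S = t}) *
    (q_number q (k + 1 - t) ^ (dim T - t) * num_above (dim T))"
  proof (rule card_le_UN)
    fix S assume S: "S \<in> {S. subspace S \<and> {0} \<subseteq> S \<and> S \<subseteq> T \<and> dim S = t}"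
    then have "\<F> \<inter> above S = above S" by (auto simp: above_def)
    then show "real (card (\<F> \<inter> above S)) \<le> q_number q (k + 1 - t) ^ (dim T - t) * num_above (dim T)"
      using above_chain[of S "dim T"] S assms tT by auto
  qed (use cover_subset_UN[OF assms(1)] in auto)
  also have "\<dots> \<le> gauss_binomial q (int (dim T)) (int t) *
    (q_number q (k + 1 - t) ^ (dim T - t) * num_above (dim T))"
    using card_subspaces_of[OF cover_subspace[OF assms(1)] tT] num_above_nonneg[OF assms(2)]
      q_number_nonneg[OF q_ge_2] by (intro mult_right_mono) auto
  finally show ?thesis .
qed

lemma card_above_noncover:
  assumes "subspace S" "\<not> cover S" "dim S < n"
  shows "real (card (above S)) \<le> q_number q (k + 1 - t) * num_above (Suc (dim S))"
proof -
  have "\<not> cover R" if "subspace R" "S \<subseteq> R" "dim R < Suc (dim S)" for R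
    using subspace_eqI[of S R] that assms by auto
  then show ?thesis using above_chain[OF assms(1), of "Suc (dim S)"] assms(3) by simp
qed

text \<open>A member \<open>F\<close> not above \<open>T\<close> meets \<open>T\<close> in a
  \<open>t\<close>-space \<open>S\<close>. For a member \<open>F'\<close> not above
  \<open>S\<close>, \<open>F \<inter> F'\<close> has dimension at least \<open>t\<close> but meets
  \<open>T\<close> only in dimension \<open>t - 1\<close>, so \<open>F\<close> contains a vector
  \<open>v\<close> of \<open>F'\<close> outside \<open>T\<close>. The \<open>(t+1)\<close>-space
  spanned by \<open>S\<close> and \<open>v\<close> differs from \<open>T\<close>, hence is not a
  cover, and one more branching step applies.\<close>

lemma card_family_unique_cover:
  assumes "cover T" "dim T = Suc t" and uniq: "\<And>T'. cover T' \<Longrightarrow> dim T' = Suc t \<Longrightarrow> T' = T"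
  shows "real (card \<F>) \<le> num_above (Suc t) + q_number q (Suc t) *
    (real q * q_number q (k - t) * (q_number q (k + 1 - t) * num_above (Suc (Suc t))))"
proof -
  let ?b = "real q * q_number q (k - t) * (q_number q (k + 1 - t) * num_above (Suc (Suc t)))"
  let ?I = "{S. subspace S \<and> {0} \<subseteq> S \<and> S \<subseteq> T \<and> dim S = t}"
  have sT: "subspace T" using assms(1) by (rule cover_subspace)
  have "real (card (\<F> - above T)) \<le> real (card ?I) * ?b"
  proof (rule card_le_UN)
    show "\<F> - above T \<subseteq> (\<Union>S\<in>?I. above S)" using cover_subset_UN[OF assms(1)] by blast
  next
    fix S assume "S \<in> ?I"
    then have S: "subspace S" "S \<subseteq> T" "dim S = t" by auto
    obtain F' where F': "F' \<in> \<F>" "\<not> S \<subseteq> F'" using exists_member_avoiding[OF S(1,3)] .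
    note sF' = member(1)[OF F'(1)]
    have sFT: "subspace (F' \<inter> T)" and sSF: "subspace (S \<inter> F')"
      using sF' sT S subspace_inter by auto
    have "dim (S \<inter> F') < t"
      using subspace_eqI[OF sSF S(1)] F'(2) S(3) by (metis Int_lower1 inf.order_iff not_less)
    moreover have "dim (F' \<inter> T) < Suc t"
      using subspace_eqI[OF sFT sT] F'(2) S(2) assms(2) by (metis Int_lower1 Int_lower2 not_less subset_trans)
    moreover have "dim (F' \<inter> T) \<ge> t" using coverD[OF assms(1) F'(1)] by (simp add: Int_commute)
    moreover have "dim (span (S \<union> F' \<inter> T)) \<le> Suc t"
      using dim_subset[OF span_minimal[of "S \<union> F' \<inter> T" T]] S(2) sT assms(2) by auto
    moreover have "dim (span (S \<union> F' \<inter> T)) + dim (S \<inter> F') = t + dim (F' \<inter> T)"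
    proof -
      have "S \<inter> (F' \<inter> T) = S \<inter> F'" using S(2) by blast
      then show ?thesis using dim_sum_Int[OF S(1) sFT] S(3) by simp
    qed
    ultimately have d: "dim (S \<inter> F') = t - 1" "dim (F' \<inter> T) = t" using t_pos by linarith+
    have "real (card ((\<F> - above T) \<inter> above S)) \<le> real q ^ 1 * q_number q (k - t) *
        (q_number q (k + 1 - t) * num_above (Suc (Suc t)))"
    proof (rule branching_card)
      fix F assume "F \<in> (\<F> - above T) \<inter> above S"
      then have F: "F \<in> \<F>" "\<not> T \<subseteq> F" "S \<subseteq> F" by (auto simp: above_def)
      show "subspace F" using F member by blast
      show "t - 1 < dim (F \<inter> F')" using intersecting[OF F(1) F'(1)] t_pos by linarith
      have sub: "subspace (F \<inter> T)" using member(1)[OF F(1)] sT subspace_inter by blast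
      have "dim (F \<inter> T) < Suc t"
        using subspace_eqI[OF sub sT] F(2) assms(2) by (metis Int_lower1 Int_lower2 not_less)
      then have "S = F \<inter> T" using subspace_eqI[OF S(1) sub] F(3) S by auto
      then show "dim (F \<inter> F' \<inter> T) \<le> t - 1" using d(1) by (simp add: Int_ac)
    next
      fix v assume v: "v \<in> F'" "v \<notin> T"
      then have vS: "v \<notin> S" using S by blast
      let ?R = "span (insert v S)"
      have R: "dim ?R = Suc t" using dim_span_insert[OF S(1) vS] S(3) by simp
      have "v \<in> ?R" using span_superset by blast
      then have "\<not> cover ?R" using uniq R v(2) by blast
      then have "real (card (above ?R)) \<le> q_number q (k + 1 - t) * num_above (Suc (Suc t))"
        using card_above_noncover[of ?R] R n_ge t_less by simp
      moreover have "{F \<in> (\<F> - above T) \<inter> above S. v \<in> F} \<subseteq> above ?R"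
        using above_insert[OF S(1)] by (auto simp: above_def)
      from card_mono[OF _ this] have
        "card {F \<in> (\<F> - above T) \<inter> above S. v \<in> F} \<le> card (above ?R)" by simp
      ultimately show "real (card {F \<in> (\<F> - above T) \<inter> above S. v \<in> F})
          \<le> q_number q (k + 1 - t) * num_above (Suc (Suc t))" by linarith
    next
      show "dim F' = t - 1 + (1 + (k - t))" using member(2)[OF F'(1)] t_less t_pos by simp
      show "dim (F' \<inter> T) = t - 1 + 1" using d t_pos by simp
    qed (fact sF' sT)+
    then show "real (card ((\<F> - above T) \<inter> above S)) \<le> ?b" by simp
  qed simp_all
  also have "\<dots> \<le> q_number q (Suc t) * ?b"
  proof (rule mult_right_mono)
    show "real (card ?I) \<le> q_number q (Suc t)"
      using card_subspaces_of[OF sT] assms(2) gauss_binomial_hyperplanes[OF q_ge_2, of t] by simp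
    show "0 \<le> ?b" using num_above_nonneg[of "Suc (Suc t)"] n_ge t_less q_number_nonneg[OF q_ge_2] by auto
  qed
  finally have 1: "real (card (\<F> - above T)) \<le> q_number q (Suc t) * ?b" .
  have "real (card (above T)) \<le> num_above (Suc t)" using card_above[OF sT] assms(2) by simp
  moreover have "card \<F> = card (above T) + card (\<F> - above T)"
    by (subst card_Un_disjoint[symmetric]) (auto simp: above_def intro: arg_cong[of _ _ card])
  ultimately show ?thesis using 1 by simp
qed

text \<open>
  For \<open>t = 1\<close>, \<open>q = 2\<close> and \<open>n = 2k + 3\<close> the estimate \<open>card_family_le_chain\<close> is too weak when the
  smallest covers have dimension 3. The next two lemmas gain a factor by distinguishing whether these
  covers have a point in common.
\<close>

lemma card_family_common_point:
  assumes "t = 1" "cover T" "dim T = 3" "subspace P" "dim P = 1" "P \<subseteq> T"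
    and noncover: "\<And>R. subspace R \<Longrightarrow> dim R < 3 \<Longrightarrow> \<not> cover R"
    and common: "\<And>T'. cover T' \<Longrightarrow> dim T' = 3 \<Longrightarrow> P \<subseteq> T'"
  shows "real (card \<F>) \<le> q_number q k ^ 2 * num_above 3 +
    (q_number q 3 - 1) * (q_number q k ^ 3 * num_above 4)"
proof -
  let ?b = "q_number q k ^ 3 * num_above 4"
  let ?I = "{S. subspace S \<and> {0} \<subseteq> S \<and> S \<subseteq> T \<and> dim S = t}"
  have sT: "subspace T" using assms(2) by (rule cover_subspace)
  have n4: "num_above 4 \<ge> 0" using num_above_nonneg n_ge t_less by simp
  have PI: "P \<in> ?I" using assms subspace_0 by auto
  have "real (card (\<F> - above P)) \<le> real (card (?I - {P})) * ?b"
  proof (rule card_le_UN)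
    show "\<F> - above P \<subseteq> (\<Union>S\<in>?I - {P}. above S)" using cover_subset_UN[OF assms(2)] by blast
  next
    fix S assume "S \<in> ?I - {P}"
    then have S: "subspace S" "S \<subseteq> T" "dim S = 1" using assms(1) by auto
    have "real (card ((\<F> - above P) \<inter> above S)) \<le> q_number q (k + 1 - t) ^ 2 * (q_number q k * num_above 4)"
    proof (rule noncover_chain)
      fix R assume R: "subspace R" "S \<subseteq> R" "dim R = dim S + 2"
      show "real (card ((\<F> - above P) \<inter> above R)) \<le> q_number q k * num_above 4"
      proof (cases "P \<subseteq> R")
        case True
        then have "(\<F> - above P) \<inter> above R = {}" by (auto simp: above_def)
        then show ?thesis using n4 q_number_nonneg[OF q_ge_2] by simp
      next
        \<comment> \<open>A 3-space that misses \<open>P\<close> is not a cover, since all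
          3-dimensional covers contain \<open>P\<close>; so the chain can climb one step further, to
          dimension 4.\<close>
        case False
        moreover have "dim R = 3" using R(3) S(3) by simp
        ultimately have "\<not> cover R" using common by blast
        then have "real (card (above R)) \<le> q_number q k * num_above 4"
          using card_above_noncover[OF R(1)] R(3) S(3) assms(1) n_ge t_less
          by (simp add: numeral_eq_Suc)
        moreover have "card ((\<F> - above P) \<inter> above R) \<le> card (above R)" by (intro card_mono) auto
        ultimately show ?thesis by linarith
      qed
    next
      fix R assume "subspace R" "S \<subseteq> R" "dim R < dim S + 2"
      then show "\<not> cover R" using noncover S by simp
    qed (use S n4 q_number_nonneg[OF q_ge_2] in auto)
    then show "real (card ((\<F> - above P) \<inter> above S)) \<le> ?b"
      using assms(1) by (simp add: power3_eq_cube power2_eq_square mult_ac)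
  qed simp_all
  also have "\<dots> \<le> (q_number q 3 - 1) * ?b"
  proof (rule mult_right_mono)
    have "real (card ?I) \<le> q_number q 3"
      using card_subspaces_of[OF sT] assms(1,3) gauss_binomial_1[of q 3] by simp
    then show "real (card (?I - {P})) \<le> q_number q 3 - 1"
      using PI card_Suc_Diff1[of ?I P] by simp
    show "0 \<le> ?b" using n4 q_number_nonneg[OF q_ge_2] by auto
  qed
  finally have 1: "real (card (\<F> - above P)) \<le> (q_number q 3 - 1) * ?b" .
  have "real (card (above P)) \<le> q_number q (k + 1 - t) ^ (3 - dim P) * num_above 3"
    using above_chain[OF assms(4), of 3] assms noncover n_ge t_less by auto
  then have "real (card (above P)) \<le> q_number q k ^ 2 * num_above 3" using assms by simp
  moreover have "card \<F> = card (above P) + card (\<F> - above P)"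
    by (subst card_Un_disjoint[symmetric]) (auto simp: above_def intro: arg_cong[of _ _ card])
  ultimately show ?thesis using 1 by simp
qed

lemma card_family_no_common_point:
  assumes "t = 1" "cover T" "dim T = 3"
    and noncover: "\<And>R. subspace R \<Longrightarrow> dim R < 3 \<Longrightarrow> \<not> cover R"
    and avoid: "\<And>P. subspace P \<Longrightarrow> dim P = 1 \<Longrightarrow> P \<subseteq> T \<Longrightarrow>
      \<exists>T'. cover T' \<and> dim T' = 3 \<and> \<not> P \<subseteq> T'"
  shows "real (card \<F>) \<le> q_number q 3 ^ 2 * q_number q k * num_above 3"
proof -
  let ?b = "q_number q 3 * (q_number q k * num_above 3)"
  let ?I = "{S. subspace S \<and> {0} \<subseteq> S \<and> S \<subseteq> T \<and> dim S = t}"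
  have sT: "subspace T" using assms(2) by (rule cover_subspace)
  have n3: "num_above 3 \<ge> 0" using num_above_nonneg n_ge t_less by simp
  have "real (card \<F>) \<le> real (card ?I) * ?b"
  proof (rule card_le_UN)
    show "\<F> \<subseteq> (\<Union>S\<in>?I. above S)" by (rule cover_subset_UN[OF assms(2)])
  next
    fix P assume "P \<in> ?I"
    then have P: "subspace P" "P \<subseteq> T" "dim P = 1" using assms(1) by auto
    then obtain T' where T': "cover T'" "dim T' = 3" "\<not> P \<subseteq> T'" using avoid by blast
    note sT' = cover_subspace[OF T'(1)]
    have sub: "subspace (T' \<inter> P)" using P sT' subspace_inter by blast
    have "\<not> 1 \<le> dim (T' \<inter> P)" using subspace_eqI[OF sub P(1)] T'(3) P(3) by auto
    then have d: "dim (T' \<inter> P) = 0" by linarith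
    \<comment> \<open>Every member through \<open>P\<close> meets the cover \<open>T'\<close> in a
      point other than \<open>P\<close>. The first step therefore branches over the points of a
      3-space instead of those of a \<open>k\<close>-space.\<close>
    have "real (card (above P)) \<le> real q ^ 0 * q_number q 3 * (q_number q k * num_above 3)"
    proof (rule branching_card)
      fix F assume "F \<in> above P"
      then have F: "F \<in> \<F>" by (simp add: above_def)
      then show "subspace F" using member by blast
      show "0 < dim (F \<inter> T')" using coverD[OF T'(1) F] t_pos by (simp add: Int_commute)
      show "dim (F \<inter> T' \<inter> P) \<le> 0" using dim_subset[of "F \<inter> T' \<inter> P" "T' \<inter> P"] d by auto
    next
      fix v assume v: "v \<notin> P"
      let ?R = "span (insert v P)"
      have R: "dim ?R = 2" using dim_span_insert[OF P(1) v] P(3) by simp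
      then have "real (card (above ?R)) \<le> q_number q k * num_above (Suc 2)"
        using card_above_noncover[of ?R] noncover[of ?R] R n_ge t_less assms(1) by simp
      moreover have "{F \<in> above P. v \<in> F} = above ?R"
        using above_insert[OF P(1)] by (auto simp: above_def)
      ultimately show "real (card {F \<in> above P. v \<in> F}) \<le> q_number q k * num_above 3"
        by (simp add: numeral_3_eq_3)
    next
      show "dim T' = 0 + (0 + 3)" using T' by simp
      show "dim (T' \<inter> P) = 0 + 0" using d by simp
    qed (fact P sT')+
    moreover have "\<F> \<inter> above P = above P" by (auto simp: above_def)
    ultimately show "real (card (\<F> \<inter> above P)) \<le> ?b" by simp
  qed simp_all
  also have "\<dots> \<le> q_number q 3 * ?b"
  proof (rule mult_right_mono)
    show "real (card ?I) \<le> q_number q 3"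
      using card_subspaces_of[OF sT] assms(1,3) gauss_binomial_1[of q 3] by simp
    show "0 \<le> ?b" using n3 q_number_nonneg[OF q_ge_2] by auto
  qed
  finally show ?thesis by (simp add: power2_eq_square mult_ac)
qed

section \<open>Three covers without a common \<open>t\<close>-space\<close>

lemma dim_cover_Int:
  assumes "cover S" "cover T" "dim S = Suc t" "dim T = Suc t" "S \<noteq> T"
  shows "dim (S \<inter> T) = t"
proof -
  have sS: "subspace S" and sT: "subspace T" using assms(1,2) cover_subspace by auto
  then have sub: "subspace (S \<inter> T)" by (rule subspace_inter)
  have "S \<inter> T \<noteq> S \<or> S \<inter> T \<noteq> T" using assms(5) by blast
  then have "dim (S \<inter> T) < Suc t"
    using dim_less[OF sub sS] dim_less[OF sub sT] assms(3,4) by auto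
  moreover have "t \<le> dim (S \<inter> T)"
    using cover_Int_cover[OF assms(1,2)] assms(3,4) t_less by simp
  ultimately show ?thesis by simp
qed

text \<open>\<open>T\<^sub>1 \<inter> T\<^sub>3\<close> and
  \<open>T\<^sub>2 \<inter> T\<^sub>3\<close> are distinct hyperplanes of \<open>T\<^sub>3\<close>,
  so they span it and \<open>T\<^sub>3\<close> lies in \<open>Z = T\<^sub>1 + T\<^sub>2\<close>. A
  member meeting \<open>Z\<close> in dimension at most \<open>t\<close> would meet all three covers
  in the same \<open>t\<close>-space, which could only be
  \<open>T\<^sub>1 \<inter> T\<^sub>2\<close>, although this is not inside \<open>T\<^sub>3\<close>.
  As \<open>H3\<close> is itself \<open>t\<close>-intersecting by
  \<open>2 * (t + 1) - (t + 2) = t\<close>, maximality gives equality.\<close>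

lemma family_eq_H3:
  assumes "cover T\<^sub>1" "cover T\<^sub>2" "cover T\<^sub>3" "dim T\<^sub>1 = Suc t" "dim T\<^sub>2 = Suc t" "dim T\<^sub>3 = Suc t"
    and "T\<^sub>1 \<noteq> T\<^sub>2" "\<not> T\<^sub>1 \<inter> T\<^sub>2 \<subseteq> T\<^sub>3"
  obtains Z where "subspace Z" "dim Z = t + 2" "\<F> = H3 scale k t Z"
proof -
  let ?Z = "span (T\<^sub>1 \<union> T\<^sub>2)"
  note sub = cover_subspace[OF assms(1)] cover_subspace[OF assms(2)] cover_subspace[OF assms(3)]
  note subI = subspace_inter[OF sub(1) sub(2)] subspace_inter[OF sub(1) sub(3)]
    subspace_inter[OF sub(2) sub(3)]
  have dX: "dim (T\<^sub>1 \<inter> T\<^sub>2) = t" using dim_cover_Int assms by blast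
  then have dZ: "dim ?Z = t + 2" using dim_sum_Int[OF sub(1,2)] assms by simp
  have TZ: "T\<^sub>1 \<subseteq> ?Z" "T\<^sub>2 \<subseteq> ?Z" using span_superset by blast+
  have T3Z: "T\<^sub>3 \<subseteq> ?Z"
  proof -
    have d: "dim (T\<^sub>1 \<inter> T\<^sub>3) = t" "dim (T\<^sub>2 \<inter> T\<^sub>3) = t"
      using dim_cover_Int assms by blast+
    have ne: "T\<^sub>1 \<inter> T\<^sub>3 \<noteq> T\<^sub>1 \<inter> T\<^sub>3 \<inter> (T\<^sub>2 \<inter> T\<^sub>3)"
    proof
      assume "T\<^sub>1 \<inter> T\<^sub>3 = T\<^sub>1 \<inter> T\<^sub>3 \<inter> (T\<^sub>2 \<inter> T\<^sub>3)"
      then have "T\<^sub>1 \<inter> T\<^sub>3 \<subseteq> T\<^sub>1 \<inter> T\<^sub>2" by blast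
      then have "T\<^sub>1 \<inter> T\<^sub>3 = T\<^sub>1 \<inter> T\<^sub>2" using subspace_eqI[OF subI(2,1)] d dX by simp
      then show False using assms(8) by blast
    qed
    have "dim (T\<^sub>1 \<inter> T\<^sub>3 \<inter> (T\<^sub>2 \<inter> T\<^sub>3)) < t"
      using dim_less[OF subspace_inter[OF subI(2,3)] subI(2)] ne d(1) by blast
    then have "Suc t \<le> dim (span (T\<^sub>1 \<inter> T\<^sub>3 \<union> T\<^sub>2 \<inter> T\<^sub>3))"
      using dim_sum_Int[OF subI(2,3)] d by simp
    moreover have "span (T\<^sub>1 \<inter> T\<^sub>3 \<union> T\<^sub>2 \<inter> T\<^sub>3) \<subseteq> T\<^sub>3" using sub(3) by (intro span_minimal) auto
    ultimately have "span (T\<^sub>1 \<inter> T\<^sub>3 \<union> T\<^sub>2 \<inter> T\<^sub>3) = T\<^sub>3"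
      using subspace_eqI[OF subspace_span sub(3)] assms(6) by simp
    moreover have "span (T\<^sub>1 \<inter> T\<^sub>3 \<union> T\<^sub>2 \<inter> T\<^sub>3) \<subseteq> ?Z" by (intro span_mono) auto
    ultimately show ?thesis by simp
  qed
  have "\<F> = H3 scale k t ?Z"
  proof (rule family_eqI)
    show "\<F> \<subseteq> H3 scale k t ?Z"
    proof
      fix F assume F: "F \<in> \<F>"
      note sF = member(1)[OF F]
      have sY: "subspace (F \<inter> ?Z)" using sF subspace_inter subspace_span by blast
      have "Suc t \<le> dim (F \<inter> ?Z)"
      proof (rule ccontr)
        assume "\<not> Suc t \<le> dim (F \<inter> ?Z)"
        then have le: "dim (F \<inter> ?Z) \<le> t" by simp
        have eq: "T \<inter> F = F \<inter> ?Z" if "cover T" "T \<subseteq> ?Z" for T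
        proof (rule subspace_eqI)
          show "subspace (T \<inter> F)" using sF cover_subspace[OF that(1)] subspace_inter by blast
          show "dim (F \<inter> ?Z) \<le> dim (T \<inter> F)" using coverD[OF that(1) F] le by simp
        qed (use that sY in auto)
        have "t \<le> dim (F \<inter> ?Z)" using coverD[OF assms(1) F] eq[OF assms(1) TZ(1)] by simp
        moreover have "F \<inter> ?Z \<subseteq> T\<^sub>1 \<inter> T\<^sub>2"
          using eq[OF assms(1) TZ(1)] eq[OF assms(2) TZ(2)] by blast
        ultimately have "F \<inter> ?Z = T\<^sub>1 \<inter> T\<^sub>2" using subspace_eqI[OF sY subI(1)] dX by simp
        then show False using eq[OF assms(3) T3Z] assms(8) by blast
      qed
      then show "F \<in> H3 scale k t ?Z" using F family_subspaces by (auto simp: H3_def)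
    qed
    show "H3 scale k t ?Z \<subseteq> subspaces scale k" by (auto simp: H3_def)
    show "t_intersecting scale t (H3 scale k t ?Z)"
      unfolding t_intersecting_def
    proof (intro ballI)
      fix A B assume "A \<in> H3 scale k t ?Z" "B \<in> H3 scale k t ?Z"
      then have AB: "subspace A" "subspace B" "t + 1 \<le> dim (A \<inter> ?Z)" "t + 1 \<le> dim (B \<inter> ?Z)"
        by (auto simp: H3_def subspaces_def)
      have "dim (A \<inter> ?Z) + dim (B \<inter> ?Z) \<le> dim ?Z + dim (A \<inter> ?Z \<inter> (B \<inter> ?Z))"
        using AB by (intro dim_Int_ge) (auto intro: subspace_inter)
      moreover have "dim (A \<inter> ?Z \<inter> (B \<inter> ?Z)) \<le> dim (A \<inter> B)" by (intro dim_subset) auto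
      ultimately show "t \<le> dim (A \<inter> B)" using AB dZ by simp
    qed
  qed
  then show ?thesis using that dZ by blast
qed

lemma card_family_H3:
  assumes "subspace Z" "dim Z = t + 2" "\<F> = H3 scale k t Z"
  shows "real (card \<F>) \<le> q_number q (t + 2) * num_above (Suc t)"
proof -
  let ?I = "{S. subspace S \<and> {0} \<subseteq> S \<and> S \<subseteq> Z \<and> dim S = Suc t}"
  have "real (card \<F>) \<le> real (card ?I) * num_above (Suc t)"
  proof (rule card_le_UN)
    show "\<F> \<subseteq> (\<Union>S\<in>?I. above S)"
    proof
      fix F assume F: "F \<in> \<F>"
      have sub: "subspace (F \<inter> Z)" using member(1)[OF F] assms(1) subspace_inter by blast
      have "Suc t \<le> dim (F \<inter> Z)" using F assms(3) by (auto simp: H3_def)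
      then obtain S where "subspace S" "{0} \<subseteq> S" "S \<subseteq> F \<inter> Z" "dim S = Suc t"
        using intermediate_subspace[OF subspace_single_0 sub, of "Suc t"] subspace_0[OF sub] by auto
      then show "F \<in> (\<Union>S\<in>?I. above S)" using F by (auto simp: above_def)
    qed
  next
    fix S assume S: "S \<in> ?I"
    have "\<F> \<inter> above S = above S" by (auto simp: above_def)
    then show "real (card (\<F> \<inter> above S)) \<le> num_above (Suc t)" using card_above[of S] S by simp
  qed simp_all
  also have "\<dots> \<le> q_number q (t + 2) * num_above (Suc t)"
  proof (rule mult_right_mono)
    have "real (card ?I) \<le> gauss_binomial q (int (Suc (Suc t))) (int (Suc t))"
      using card_subspaces_between[of "{0}" Z "Suc t"] assms(1,2) subspace_0[OF assms(1)] by simp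
    then show "real (card ?I) \<le> q_number q (t + 2)"
      unfolding gauss_binomial_hyperplanes[OF q_ge_2] by simp
    show "num_above (Suc t) \<ge> 0" using num_above_nonneg n_ge t_less by simp
  qed
  finally show ?thesis .
qed

end

section \<open>Families whose small covers share a subspace\<close>

locale star_family = nontrivial_family +
  fixes X
  assumes subspace_X: "subspace X" and dim_X: "dim X = t"
    and cover_above_X: "\<And>T. cover T \<Longrightarrow> dim T = Suc t \<Longrightarrow> X \<subseteq> T"
    and two_covers: "\<exists>T T'. cover T \<and> cover T' \<and> dim T = Suc t \<and> dim T' = Suc t \<and> T \<noteq> T'"
begin

definition "M = span (\<Union>{T. cover T \<and> dim T = Suc t})"

lemma cover_subset_M: "cover T \<Longrightarrow> dim T = Suc t \<Longrightarrow> T \<subseteq> M"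
  unfolding M_def by (intro order_trans[OF _ span_superset]) auto

lemma subspace_M: "subspace M"
  by (simp add: M_def)

lemma X_subset_M: "X \<subseteq> M"
proof -
  obtain T where "cover T" "dim T = Suc t" using two_covers by blast
  then show ?thesis using cover_above_X cover_subset_M by (meson order_trans)
qed

lemma dim_M_ge: "t + 2 \<le> dim M"
proof -
  obtain T T' where T: "cover T" "cover T'" "dim T = Suc t" "dim T' = Suc t" "T \<noteq> T'"
    using two_covers by blast
  have "dim (span (T \<union> T')) = t + 2"
    using dim_sum_Int[OF cover_subspace[OF T(1)] cover_subspace[OF T(2)]] dim_cover_Int[OF T] T
    by simp
  moreover have "span (T \<union> T') \<subseteq> M"
    using T cover_subset_M subspace_M by (intro span_minimal) auto
  ultimately show ?thesis using dim_subset by metis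
qed

text \<open>For a \<open>(t+1)\<close>-dimensional cover \<open>T\<close>, the space
  \<open>T \<inter> F\<close> has dimension at least \<open>t\<close> and meets \<open>X\<close> in
  dimension less than \<open>t\<close>; hence \<open>T = X + (T \<inter> F)\<close> lies in
  \<open>X + F\<close>, and so does \<open>M\<close>. Then \<open>M + F = X + F\<close>, so
  \<open>F\<close> cuts \<open>M\<close> in a hyperplane.\<close>

lemma member_not_above_X:
  assumes F: "F \<in> \<F>" and "\<not> X \<subseteq> F"
  shows "dim (X \<inter> F) = t - 1" "dim (span (X \<union> F)) = Suc k" "M \<subseteq> span (X \<union> F)"
    "Suc (dim (M \<inter> F)) = dim M"
proof -
  note sF = member(1)[OF F]
  have sXF: "subspace (X \<inter> F)" using sF subspace_X subspace_inter by blast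
  have lt: "dim (X \<inter> F) < t" using dim_less[OF sXF subspace_X] assms(2) dim_X by blast
  have T: "dim (X \<inter> F) = t - 1 \<and> T \<subseteq> span (X \<union> F)" if T: "cover T" "dim T = Suc t" for T
  proof -
    note sT = cover_subspace[OF T(1)]
    have sTF: "subspace (T \<inter> F)" using sF sT subspace_inter by blast
    have XT: "X \<subseteq> T" using cover_above_X T by blast
    then have *: "X \<inter> (T \<inter> F) = X \<inter> F" by blast
    have ge: "t \<le> dim (T \<inter> F)" using coverD[OF T(1) F] .
    have "dim X + dim (T \<inter> F) \<le> dim T + dim (X \<inter> F)"
      using dim_Int_ge[OF subspace_X sTF sT XT] * by simp
    then have d: "dim (X \<inter> F) = t - 1" using lt ge dim_X T(2) by linarith
    have "dim (span (X \<union> (T \<inter> F))) \<ge> dim T"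
      using dim_sum_Int[OF subspace_X sTF] * d ge dim_X T(2) t_pos by simp
    moreover have "span (X \<union> (T \<inter> F)) \<subseteq> T" using XT sT by (intro span_minimal) auto
    ultimately have "span (X \<union> (T \<inter> F)) = T" using subspace_eqI[OF subspace_span sT] by blast
    moreover have "span (X \<union> (T \<inter> F)) \<subseteq> span (X \<union> F)" by (intro span_mono) auto
    ultimately show ?thesis using d by simp
  qed
  obtain T where "cover T" "dim T = Suc t" using two_covers by blast
  then show d: "dim (X \<inter> F) = t - 1" using T by blast
  show dS: "dim (span (X \<union> F)) = Suc k"
    using dim_sum_Int[OF subspace_X sF] d dim_X t_pos member(2)[OF F] by simp
  show MS: "M \<subseteq> span (X \<union> F)"
    unfolding M_def using T by (intro span_minimal) auto
  have "span (M \<union> F) = span (X \<union> F)"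
  proof
    show "span (M \<union> F) \<subseteq> span (X \<union> F)"
      using MS span_superset[of "X \<union> F"] by (intro span_minimal) auto
    show "span (X \<union> F) \<subseteq> span (M \<union> F)" using X_subset_M by (intro span_mono) auto
  qed
  then show "Suc (dim (M \<inter> F)) = dim M"
    using dim_sum_Int[OF subspace_M sF] dS member(2)[OF F] by simp
qed

text \<open>A member not above \<open>X\<close> cuts \<open>M\<close> in a hyperplane, so it loses
  at most one dimension of \<open>T\<close>. Thus the \<open>(t+1)\<close>-dimensional covers are
  exactly the \<open>(t+1)\<close>-spaces between \<open>X\<close> and \<open>M\<close>.\<close>

lemma cover_between:
  assumes "subspace T" "X \<subseteq> T" "T \<subseteq> M" "dim T = Suc t"
  shows "cover T"
  unfolding cover_def
proof (intro conjI ballI)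
  fix F assume F: "F \<in> \<F>"
  note sF = member(1)[OF F]
  show "t \<le> dim (T \<inter> F)"
  proof (cases "X \<subseteq> F")
    case True
    then have "dim X \<le> dim (T \<inter> F)" using assms(2) by (intro dim_subset) auto
    then show ?thesis using dim_X by simp
  next
    case False
    have "dim T + dim (M \<inter> F) \<le> dim M + dim (T \<inter> (M \<inter> F))"
      using assms sF subspace_M by (intro dim_Int_ge) (auto intro: subspace_inter)
    moreover have "T \<inter> (M \<inter> F) = T \<inter> F" using assms(3) by blast
    ultimately show ?thesis using member_not_above_X(4)[OF F False] assms(4) by simp
  qed
qed (fact assms)

lemma memberI_star:
  assumes "subspace F" "dim F = k" "X \<subseteq> F" "Suc t \<le> dim (F \<inter> M)"
  shows "F \<in> \<F>"
proof -
  have "subspace (F \<inter> M)" using assms(1) subspace_M subspace_inter by blast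
  then obtain T where "subspace T" "X \<subseteq> T" "T \<subseteq> F \<inter> M" "dim T = Suc t"
    using intermediate_subspace[OF subspace_X, of "F \<inter> M" "Suc t"] X_subset_M assms dim_X by auto
  then show ?thesis using cover_between memberI_cover[of T F] assms by auto
qed

lemma dim_M_le: "dim M \<le> Suc k"
proof -
  obtain F where "F \<in> \<F>" "\<not> X \<subseteq> F" using exists_member_avoiding[OF subspace_X dim_X] .
  note F = member_not_above_X[OF this]
  show ?thesis using dim_subset[OF F(3)] F(2) by simp
qed

text \<open>Members in \<open>A\<close> contain one of the covers between \<open>X\<close> and
  \<open>M\<close>. For \<open>F\<close> in \<open>B\<close> and a fixed member \<open>F'\<close>
  not above \<open>X\<close>, \<open>F \<inter> F'\<close> has dimension at least \<open>t\<close>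
  but meets \<open>M\<close> in \<open>X \<inter> F'\<close>, of dimension \<open>t - 1\<close>; so
  \<open>F\<close> contains a vector of \<open>F'\<close> outside \<open>M\<close>, and with
  \<open>X\<close> it spans a non-cover. Members in \<open>C\<close> cut \<open>M\<close> in a
  hyperplane that does not contain \<open>X\<close>.\<close>

lemma card_family_star:
  assumes "dim M = t + j" "j \<le> k - t"
  shows "real (card \<F>) \<le> q_number q j * num_above (Suc t) +
    (real q ^ j * q_number q (k + 1 - t - j) + q_number q (t + j)) *
      (q_number q (k + 1 - t) * num_above (Suc (Suc t)))"
proof -
  let ?b = "q_number q (k + 1 - t) * num_above (Suc (Suc t))"
  define A where "A = {F \<in> \<F>. X \<subseteq> F \<and> Suc t \<le> dim (F \<inter> M)}"
  define B where "B = {F \<in> \<F>. X \<subseteq> F \<and> F \<inter> M = X}"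
  define C where "C = {F \<in> \<F>. \<not> X \<subseteq> F}"
  have b0: "0 \<le> ?b"
    using num_above_nonneg n_ge t_less q_number_nonneg[OF q_ge_2] by simp
  have noncover: "real (card (above R)) \<le> ?b"
    if "subspace R" "dim R = Suc t" "\<not> cover R" for R
    using card_above_noncover[OF that(1,3)] that(2) n_ge t_less by simp
  have "\<F> \<subseteq> A \<union> B \<union> C"
  proof
    fix F assume F: "F \<in> \<F>"
    have sFM: "subspace (F \<inter> M)" using member(1)[OF F] subspace_M subspace_inter by blast
    have "F \<inter> M = X" if "X \<subseteq> F" "\<not> Suc t \<le> dim (F \<inter> M)"
      using subspace_eqI[OF subspace_X sFM] that X_subset_M dim_X by auto
    then show "F \<in> A \<union> B \<union> C" using F by (auto simp: A_def B_def C_def)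
  qed
  from card_mono[OF _ this] have "card \<F> \<le> card A + card B + card C"
    using card_Un_le[of "A \<union> B" C] card_Un_le[of A B] by simp
  moreover have "real (card A) \<le> q_number q j * num_above (Suc t)"
  proof -
    let ?I = "{S. subspace S \<and> X \<subseteq> S \<and> S \<subseteq> M \<and> dim S = Suc t}"
    have "real (card A) \<le> real (card ?I) * num_above (Suc t)"
    proof (rule card_le_UN)
      show "A \<subseteq> (\<Union>S\<in>?I. above S)"
      proof
        fix F assume "F \<in> A"
        then have F: "F \<in> \<F>" "X \<subseteq> F" "Suc t \<le> dim (F \<inter> M)" by (auto simp: A_def)
        have "subspace (F \<inter> M)" using member(1)[OF F(1)] subspace_M subspace_inter by blast
        then obtain S where "subspace S" "X \<subseteq> S" "S \<subseteq> F \<inter> M" "dim S = Suc t"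
          using intermediate_subspace[OF subspace_X, of "F \<inter> M" "Suc t"] X_subset_M F dim_X by auto
        then show "F \<in> (\<Union>S\<in>?I. above S)" using F by (auto simp: above_def)
      qed
    next
      fix S assume S: "S \<in> ?I"
      have "card (A \<inter> above S) \<le> card (above S)" by (intro card_mono) auto
      then show "real (card (A \<inter> above S)) \<le> num_above (Suc t)" using card_above[of S] S by simp
    qed simp_all
    also have "\<dots> \<le> q_number q j * num_above (Suc t)"
    proof (rule mult_right_mono)
      show "real (card ?I) \<le> q_number q j"
        using card_subspaces_between[OF subspace_X subspace_M X_subset_M, of "Suc t"] dim_M_ge dim_X
          assms(1) gauss_binomial_1[of q j] by simp
      show "num_above (Suc t) \<ge> 0" using num_above_nonneg n_ge t_less by simp
    qed
    finally show ?thesis .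
  qed
  moreover have "real (card B) \<le> real q ^ j * q_number q (k + 1 - t - j) * ?b"
  proof -
    obtain F' where F': "F' \<in> \<F>" "\<not> X \<subseteq> F'" using exists_member_avoiding[OF subspace_X dim_X] .
    note d = member_not_above_X[OF F']
    show ?thesis
    proof (rule branching_card)
      fix F assume "F \<in> B"
      then have F: "F \<in> \<F>" "F \<inter> M = X" by (auto simp: B_def)
      show "subspace F" using F(1) member by blast
      show "t - 1 < dim (F \<inter> F')" using intersecting[OF F(1) F'(1)] t_pos by linarith
      have "F \<inter> F' \<inter> M = X \<inter> F'" using F(2) by blast
      then show "dim (F \<inter> F' \<inter> M) \<le> t - 1" using d(1) by simp
    next
      fix v assume v: "v \<in> F'" "v \<notin> M"
      let ?R = "span (insert v X)"
      have vX: "v \<notin> X" using v X_subset_M by blast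
      have R: "dim ?R = Suc t" using dim_span_insert[OF subspace_X vX] dim_X by simp
      have "v \<in> ?R" using span_superset by blast
      then have "\<not> cover ?R" using cover_subset_M[OF _ R] v(2) by blast
      then have "real (card (above ?R)) \<le> ?b" using noncover R by simp
      moreover have "{F \<in> B. v \<in> F} \<subseteq> above ?R"
        using above_insert[OF subspace_X] by (auto simp: above_def B_def)
      from card_mono[OF _ this] have "card {F \<in> B. v \<in> F} \<le> card (above ?R)" by simp
      ultimately show "real (card {F \<in> B. v \<in> F}) \<le> ?b" by linarith
    next
      show "dim F' = t - 1 + (j + (k + 1 - t - j))"
        using member(2)[OF F'(1)] t_less t_pos assms(2) by simp
      show "dim (F' \<inter> M) = t - 1 + j"
        using d(4) assms(1) t_pos by (simp add: Int_commute)
    qed (fact member(1)[OF F'(1)] subspace_M)+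
  qed
  moreover have "real (card C) \<le> q_number q (t + j) * ?b"
  proof -
    let ?I = "{S. subspace S \<and> {0} \<subseteq> S \<and> S \<subseteq> M \<and> dim S = t + j - 1}"
    have "real (card C) \<le> real (card ?I) * ?b"
    proof (rule card_le_UN)
      show "C \<subseteq> (\<Union>S\<in>?I. above S)"
      proof
        fix F assume "F \<in> C"
        then have F: "F \<in> \<F>" "\<not> X \<subseteq> F" by (auto simp: C_def)
        have sub: "subspace (M \<inter> F)" using member(1)[OF F(1)] subspace_M subspace_inter by blast
        moreover have "dim (M \<inter> F) = t + j - 1" using member_not_above_X(4)[OF F] assms(1) by simp
        ultimately have "M \<inter> F \<in> ?I" using subspace_0 by auto
        moreover have "F \<in> above (M \<inter> F)" using F by (auto simp: above_def)
        ultimately show "F \<in> (\<Union>S\<in>?I. above S)" by blast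
      qed
    next
      fix S assume "S \<in> ?I"
      then have S: "subspace S" "S \<subseteq> M" "dim S = t + j - 1" by auto
      show "real (card (C \<inter> above S)) \<le> ?b"
      proof (cases "X \<subseteq> S")
        case True
        then have "C \<inter> above S = {}" by (auto simp: C_def above_def)
        then show ?thesis using b0 by simp
      next
        case False
        \<comment> \<open>Here \<open>j \<ge> 2\<close> gives room for a \<open>(t+1)\<close>-space
          \<open>R\<close> inside the hyperplane \<open>S\<close>. It does not contain
          \<open>X\<close>, so it is not a cover.\<close>
        have "Suc t \<le> dim S" using dim_M_ge assms(1) S(3) by simp
        moreover have sXS: "subspace (X \<inter> S)" using S(1) subspace_X subspace_inter by blast
        have "dim (X \<inter> S) < t" using dim_less[OF sXS subspace_X] False dim_X by blast
        ultimately obtain R where R: "subspace R" "R \<subseteq> S" "dim R = Suc t"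
          using intermediate_subspace[OF subspace_single_0 S(1), of "Suc t"] subspace_0[OF S(1)] by auto
        have "\<not> cover R" using cover_above_X R False by blast
        then have "real (card (above R)) \<le> ?b" using noncover R by blast
        moreover have "C \<inter> above S \<subseteq> above R" using R(2) by (auto simp: above_def)
        from card_mono[OF _ this] have "card (C \<inter> above S) \<le> card (above R)" by simp
        ultimately show ?thesis by linarith
      qed
    qed simp_all
    also have "\<dots> \<le> q_number q (t + j) * ?b"
    proof (rule mult_right_mono)
      obtain m where m: "t + j = Suc m" using t_pos by (cases "t + j") auto
      have "real (card ?I) \<le> gauss_binomial q (int (Suc m)) (int m)"
        using card_subspaces_between[of "{0}" M m] subspace_M subspace_0[OF subspace_M] assms(1) m
        by simp
      then show "real (card ?I) \<le> q_number q (t + j)"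
        unfolding gauss_binomial_hyperplanes[OF q_ge_2] m .
    qed (fact b0)
    finally show ?thesis .
  qed
  ultimately have "real (card \<F>) \<le> q_number q j * num_above (Suc t) +
      real q ^ j * q_number q (k + 1 - t - j) * ?b + q_number q (t + j) * ?b" by linarith
  then show ?thesis by (simp add: distrib_right)
qed

text \<open>
  With \<open>dim M = k + 1\<close> the role of \<open>C\<close> is played by \<open>M\<close>, and any \<open>k\<close>-space between \<open>X\<close> and \<open>M\<close>
  can serve as the second parameter.
\<close>

lemma star_eq_H2_Suc:
  assumes dM: "dim M = Suc k" and M': "subspace M'" "X \<subseteq> M'" "M' \<subseteq> M" "dim M' = k"
  shows "\<F> = H2 scale k t X M' M"
proof -
  have below: "F \<subseteq> M" if F: "F \<in> \<F>" "\<not> X \<subseteq> F" for F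
    using subspace_eqI[OF subspace_M subspace_span, of "X \<union> F"] member_not_above_X[OF F] dM
      span_superset[of "X \<union> F"] by auto
  obtain F' where F': "F' \<in> \<F>" "\<not> X \<subseteq> F'" using exists_member_avoiding[OF subspace_X dim_X] .
  \<comment> \<open>A member meeting \<open>M\<close> only in \<open>X\<close> would meet
    \<open>F'\<close>, which lies in \<open>M\<close>, in \<open>X \<inter> F'\<close>, of dimension
    \<open>t - 1\<close>.\<close>
  have large: "Suc t \<le> dim (F \<inter> M)" if F: "F \<in> \<F>" "X \<subseteq> F" for F
  proof (rule ccontr)
    assume "\<not> Suc t \<le> dim (F \<inter> M)"
    moreover have "subspace (F \<inter> M)" using member(1)[OF F(1)] subspace_M subspace_inter by blast
    ultimately have "X = F \<inter> M"
      using F(2) X_subset_M dim_X by (intro subspace_eqI[OF subspace_X]) auto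
    then have "F \<inter> F' = X \<inter> F'" using below[OF F'] by blast
    then show False
      using intersecting[OF F(1) F'(1)] member_not_above_X(1)[OF F'] t_pos by simp
  qed
  show ?thesis
  proof
    show "\<F> \<subseteq> H2 scale k t X M' M"
    proof
      fix F assume F: "F \<in> \<F>"
      note sF = member(1)[OF F]
      have Fk: "F \<in> subspaces scale k" using F family_subspaces by blast
      show "F \<in> H2 scale k t X M' M"
      proof (cases "X \<subseteq> F")
        case True
        have sub: "subspace (F \<inter> M')" "subspace (F \<inter> M)"
          using sF M'(1) subspace_M subspace_inter by blast+
        show ?thesis
        proof (cases "t + 1 \<le> dim (F \<inter> M')")
          case True
          then show ?thesis using Fk \<open>X \<subseteq> F\<close> by (simp add: H2_def family_A_def)
        next
          case False
          then have eq: "F \<inter> M' = X"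
            using True M'(2) dim_X subspace_eqI[OF subspace_X sub(1)] by auto
          have "F \<inter> M \<inter> M' = X" using eq M'(3) by blast
          then have "dim (F \<inter> M) \<le> Suc t"
            using dim_Int_ge[OF sub(2) M'(1) subspace_M] M' dM dim_X by auto
          \<comment> \<open>The right side is \<open>t + 1\<close>, as
            \<open>dim M = k + 1\<close>.\<close>
          then have "dim (F \<inter> M) = dim M - k + t"
            using large[OF F True] dM by simp
          then show ?thesis using Fk eq by (simp add: H2_def family_B_def)
        qed
      next
        case False
        note FM = below[OF F False]
        have "k + k \<le> Suc k + dim (F \<inter> M')"
          using dim_Int_ge[OF sF M'(1) subspace_M FM M'(3)] member(2)[OF F] M'(4) dM by simp
        moreover have "F \<inter> M' \<noteq> F" using False subspace_eqI[OF sF M'(1)] M' member(2)[OF F] by auto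
        then have "dim (F \<inter> M') < k"
          using dim_less[OF _ sF, of "F \<inter> M'"] subspace_inter[OF sF M'(1)] member(2)[OF F] by auto
        ultimately have "dim (F \<inter> M') = k - 1" by simp
        then show ?thesis
          using Fk FM member_not_above_X(1)[OF F False]
          by (simp add: H2_def family_C_def Int_commute)
      qed
    qed
    show "H2 scale k t X M' M \<subseteq> \<F>"
    proof
      fix F assume "F \<in> H2 scale k t X M' M"
      then consider "F \<in> family_A scale k t X M'" | "F \<in> family_B scale k t X M' M"
        | "F \<in> family_C scale k t X M' M" by (auto simp: H2_def)
      then show "F \<in> \<F>"
      proof cases
        case 1
        then have F: "subspace F" "dim F = k" "X \<subseteq> F" "Suc t \<le> dim (F \<inter> M')"
          by (auto simp: family_A_def subspaces_def)
        moreover have "dim (F \<inter> M') \<le> dim (F \<inter> M)" using M'(3) by (intro dim_subset) auto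
        ultimately show ?thesis using memberI_star by simp
      next
        case 2
        then show ?thesis using memberI_star dM by (auto simp: family_B_def subspaces_def)
      next
        \<comment> \<open>\<open>F\<close> is a hyperplane of \<open>M\<close>. Members above
          \<open>X\<close> meet \<open>M\<close> in dimension at least \<open>t + 1\<close>, the
          others are hyperplanes of \<open>M\<close> as well, so each meets \<open>F\<close> in
          dimension at least \<open>t\<close>.\<close>
        case 3
        then have F: "subspace F" "dim F = k" "F \<subseteq> M" by (auto simp: family_C_def subspaces_def)
        show ?thesis
        proof (rule memberI)
          fix G assume G: "G \<in> \<F>"
          note sG = member(1)[OF G]
          show "t \<le> dim (F \<inter> G)"
          proof (cases "X \<subseteq> G")
            case True
            have "dim F + dim (G \<inter> M) \<le> dim M + dim (F \<inter> (G \<inter> M))"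
              using F sG subspace_M by (intro dim_Int_ge) (auto intro: subspace_inter)
            moreover have "F \<inter> (G \<inter> M) = F \<inter> G" using F(3) by blast
            ultimately show ?thesis using large[OF G True] dM F(2) by simp
          next
            case False
            then show ?thesis
              using dim_Int_ge[OF F(1) sG subspace_M F(3) below[OF G False]] F(2) member(2)[OF G]
                dM t_less by simp
          qed
        qed (fact F)+
      qed
    qed
  qed
qed

text \<open>The inclusion means \<open>F + D = F + M\<close>, and \<open>F + M\<close> has dimension
  \<open>2 * k - t\<close>. The right side is the dimension condition of
  \<open>family_B\<close>.\<close>

lemma subset_span_iff:
  assumes "subspace F" "dim F = k" "F \<inter> M = X" "dim M = k" "subspace D" "M \<subseteq> D"
  shows "D \<subseteq> span (F \<union> M) \<longleftrightarrow> dim (F \<inter> D) + k = dim D + t"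
proof -
  have FM: "dim (span (F \<union> M)) + t = 2 * k"
    using dim_sum_Int[OF assms(1) subspace_M] assms dim_X by simp
  have FD: "dim (span (F \<union> D)) + dim (F \<inter> D) = k + dim D"
    using dim_sum_Int[OF assms(1,5)] assms(2) by simp
  have sub: "span (F \<union> M) \<subseteq> span (F \<union> D)" using assms(6) by (intro span_mono) auto
  have "D \<subseteq> span (F \<union> M) \<longleftrightarrow> span (F \<union> D) = span (F \<union> M)"
  proof
    assume "D \<subseteq> span (F \<union> M)"
    then have "span (F \<union> D) \<subseteq> span (F \<union> M)"
      using span_superset[of "F \<union> M"] by (intro span_minimal) auto
    then show "span (F \<union> D) = span (F \<union> M)" using sub by blast
  next
    assume "span (F \<union> D) = span (F \<union> M)"
    then show "D \<subseteq> span (F \<union> M)" using span_superset[of "F \<union> D"] by auto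
  qed
  also have "\<dots> \<longleftrightarrow> dim (span (F \<union> D)) = dim (span (F \<union> M))"
    using subspace_eqI[OF subspace_span subspace_span sub] by (metis order_refl)
  finally show ?thesis using FM FD by linarith
qed

text \<open>Both sides say that \<open>F\<close> meets the \<open>(k+1)\<close>-space
  \<open>E = X + F'\<close> in dimension \<open>t + 1\<close>. If \<open>F \<inter> F'\<close> has
  dimension at least \<open>t\<close>, adding \<open>X\<close> yields \<open>t + 1\<close>;
  conversely \<open>F'\<close> is a hyperplane of \<open>E\<close>.\<close>

lemma intersecting_iff_subset_span:
  assumes "subspace F" "dim F = k" "F \<inter> M = X" "dim M = k"
    and "subspace F'" "dim F' = k" "dim (X \<inter> F') = t - 1" "M \<subseteq> span (X \<union> F')"
  shows "t \<le> dim (F \<inter> F') \<longleftrightarrow> span (X \<union> F') \<subseteq> span (F \<union> M)"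
proof -
  let ?E = "span (X \<union> F')"
  have dE: "dim ?E = Suc k"
    using dim_sum_Int[OF subspace_X assms(5)] dim_X assms t_pos by simp
  have FE: "F' \<subseteq> ?E" "X \<subseteq> ?E" using span_superset[of "X \<union> F'"] by auto
  have XF: "X \<subseteq> F" using assms(3) by blast
  have sub: "subspace (F \<inter> F')" "subspace (F \<inter> ?E)"
    using assms subspace_inter subspace_span by blast+
  have iff: "?E \<subseteq> span (F \<union> M) \<longleftrightarrow> dim (F \<inter> ?E) = Suc t"
    using subset_span_iff[OF assms(1-4) subspace_span assms(8)] dE by auto
  have le: "dim (F \<inter> ?E) \<le> Suc t"
  proof -
    have "F \<inter> ?E \<inter> M = X" using assms(3) X_subset_M FE by blast
    then show ?thesis
      using dim_Int_ge[OF sub(2) subspace_M subspace_span _ assms(8)] dE dim_X assms(4) by auto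
  qed
  show ?thesis
  proof
    assume t: "t \<le> dim (F \<inter> F')"
    have "X \<inter> (F \<inter> F') = X \<inter> F'" using XF by blast
    then have "Suc t \<le> dim (span (X \<union> (F \<inter> F')))"
      using dim_sum_Int[OF subspace_X sub(1)] dim_X assms(7) t t_pos by simp
    also have "\<dots> \<le> dim (F \<inter> ?E)"
      using XF FE sub(2) by (intro dim_subset span_minimal) auto
    finally show "?E \<subseteq> span (F \<union> M)" using iff le by simp
  next
    assume "?E \<subseteq> span (F \<union> M)"
    then have "dim (F \<inter> ?E) = Suc t" using iff by simp
    moreover have "F \<inter> ?E \<inter> F' = F \<inter> F'" using FE by blast
    ultimately show "t \<le> dim (F \<inter> F')"
      using dim_Int_ge[OF sub(2) assms(5) subspace_span _ FE(1)] dE assms(6) by auto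
  qed
qed

lemma Int_M_cases:
  assumes "F \<in> \<F>" "X \<subseteq> F"
  obtains "Suc t \<le> dim (F \<inter> M)" | "F \<inter> M = X"
proof -
  have "subspace (F \<inter> M)" using member(1)[OF assms(1)] subspace_M subspace_inter by blast
  then show ?thesis
    using that subspace_eqI[OF subspace_X, of "F \<inter> M"] X_subset_M assms(2) dim_X
    by (metis Int_subset_iff not_less_eq_eq)
qed

text \<open>\<open>F \<inter> M\<close> is a hyperplane of \<open>M\<close>, which settles all
  members \<open>G\<close> with \<open>dim (G \<inter> M) \<ge> t + 1\<close>, in particular those
  not above \<open>X\<close>. Only members with \<open>G \<inter> M = X\<close> call for the last
  assumption. \<open>D\<close> is arbitrary, as both \<open>C\<close> and the whole space are
  substituted for it.\<close>

lemma family_C_member: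
  assumes "dim M = k" "F \<in> family_C scale k t X M D"
    and "\<And>G. G \<in> \<F> \<Longrightarrow> G \<inter> M = X \<Longrightarrow> span (X \<union> F) \<subseteq> span (G \<union> M)"
  shows "F \<in> \<F>"
proof -
  have F: "subspace F" "dim F = k" "dim (X \<inter> F) = t - 1" "dim (F \<inter> M) = k - 1"
    using assms(2) by (auto simp: family_C_def subspaces_def Int_commute)
  have sFM: "subspace (F \<inter> M)" using F(1) subspace_M subspace_inter by blast
  show ?thesis
  proof (rule memberI)
    fix G assume G: "G \<in> \<F>"
    note sG = member(1)[OF G]
    have sGM: "subspace (G \<inter> M)" using sG subspace_M subspace_inter by blast
    have *: "t \<le> dim (F \<inter> G)" if "Suc t \<le> dim (G \<inter> M)"
    proof -
      have "dim (F \<inter> M) + dim (G \<inter> M) \<le> dim M + dim (F \<inter> M \<inter> (G \<inter> M))"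
        using sFM sGM subspace_M by (intro dim_Int_ge) auto
      moreover have "dim (F \<inter> M \<inter> (G \<inter> M)) \<le> dim (F \<inter> G)" by (intro dim_subset) auto
      ultimately show ?thesis using that F(4) assms(1) t_less by linarith
    qed
    show "t \<le> dim (F \<inter> G)"
    proof (cases "X \<subseteq> G")
      case True
      show ?thesis using G True
      proof (cases rule: Int_M_cases)
        case 1
        then show ?thesis by (rule *)
      next
        case 2
        have "X \<inter> (F \<inter> M) = X \<inter> F" using X_subset_M by blast
        then have "dim (span (X \<union> (F \<inter> M))) = k"
          using dim_sum_Int[OF subspace_X sFM] dim_X F t_pos t_less by simp
        moreover have "span (X \<union> (F \<inter> M)) \<subseteq> M" using X_subset_M subspace_M by (intro span_minimal) auto
        ultimately have "span (X \<union> (F \<inter> M)) = M"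
          using subspace_eqI[OF subspace_span subspace_M] assms(1) by simp
        moreover have "span (X \<union> (F \<inter> M)) \<subseteq> span (X \<union> F)" by (intro span_mono) auto
        ultimately have "M \<subseteq> span (X \<union> F)" by simp
        then show ?thesis
          using intersecting_iff_subset_span[OF sG member(2)[OF G] 2 assms(1) F(1-3)] assms(3)[OF G 2]
          by (simp add: Int_commute)
      qed
    next
      case False
      have "Suc (dim (G \<inter> M)) = k"
        using member_not_above_X(4)[OF G False] assms(1) by (simp add: Int_commute)
      then show ?thesis using t_less by (intro *) simp
    qed
  qed (fact F)+
qed

lemma star_eq_H2:
  assumes dM: "dim M = k"
  obtains C where "subspace C" "M \<subseteq> C" "dim C \<in> {k + 1..2 * k - t} \<union> {n}" "\<F> = H2 scale k t X M C"
proof -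
  \<comment> \<open>By \<open>intersecting_iff_subset_span\<close>, a \<open>k\<close>-space
    \<open>F\<close> with \<open>F \<inter> M = X\<close> is compatible with \<open>F'\<close> if
    and only if \<open>F + M\<close> contains \<open>X + F'\<close>. Collecting all these spaces
    gives one condition, \<open>C \<subseteq> F + M\<close>.\<close>
  define C where "C = span (M \<union> \<Union>{F \<in> \<F>. \<not> X \<subseteq> F})"
  have sC: "subspace C" by (simp add: C_def)
  have MC: "M \<subseteq> C" unfolding C_def by (intro order_trans[OF _ span_superset]) auto
  have NC: "F \<subseteq> C" if "F \<in> \<F>" "\<not> X \<subseteq> F" for F
    unfolding C_def using that by (intro order_trans[OF _ span_superset]) auto
  have EC: "span (X \<union> F) \<subseteq> C" if "F \<in> \<F>" "\<not> X \<subseteq> F" for F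
    using NC[OF that] MC X_subset_M sC by (intro span_minimal) auto
  have Fk: "F \<in> subspaces scale k" if "F \<in> \<F>" for F using that family_subspaces by blast
  have C_iff: "C \<subseteq> span (F \<union> M) \<longleftrightarrow>
      (\<forall>F'\<in>\<F>. \<not> X \<subseteq> F' \<longrightarrow> span (X \<union> F') \<subseteq> span (F \<union> M))" for F
  proof
    assume "C \<subseteq> span (F \<union> M)"
    then show "\<forall>F'\<in>\<F>. \<not> X \<subseteq> F' \<longrightarrow> span (X \<union> F') \<subseteq> span (F \<union> M)"
      using EC by (meson order_trans)
  next
    assume *: "\<forall>F'\<in>\<F>. \<not> X \<subseteq> F' \<longrightarrow> span (X \<union> F') \<subseteq> span (F \<union> M)"
    have "F' \<subseteq> span (F \<union> M)" if "F' \<in> \<F>" "\<not> X \<subseteq> F'" for F'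
      using * that span_superset[of "X \<union> F'"] by (meson Un_subset_iff order_trans)
    moreover have "M \<subseteq> span (F \<union> M)" using span_superset[of "F \<union> M"] by auto
    ultimately show "C \<subseteq> span (F \<union> M)" unfolding C_def by (intro span_minimal) auto
  qed
  have in_iff: "F \<in> \<F> \<longleftrightarrow> dim (F \<inter> C) + k = dim C + t"
    if F: "subspace F" "dim F = k" "F \<inter> M = X" for F
  proof -
    \<comment> \<open>Members above \<open>X\<close> share \<open>X\<close> with \<open>F\<close>,
      so only the others have to be tested.\<close>
    have "F \<in> \<F> \<longleftrightarrow> (\<forall>F'\<in>\<F>. \<not> X \<subseteq> F' \<longrightarrow> t \<le> dim (F \<inter> F'))"
    proof
      assume "F \<in> \<F>"
      then show "\<forall>F'\<in>\<F>. \<not> X \<subseteq> F' \<longrightarrow> t \<le> dim (F \<inter> F')" using intersecting by blast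
    next
      assume *: "\<forall>F'\<in>\<F>. \<not> X \<subseteq> F' \<longrightarrow> t \<le> dim (F \<inter> F')"
      have "t \<le> dim (F \<inter> G)" if "X \<subseteq> G" for G
        using dim_subset[of X "F \<inter> G"] that F(3) dim_X by auto
      then show "F \<in> \<F>" using * by (intro memberI[OF F(1,2)]) blast
    qed
    also have "\<dots> \<longleftrightarrow> C \<subseteq> span (F \<union> M)"
    proof -
      have "t \<le> dim (F \<inter> F') \<longleftrightarrow> span (X \<union> F') \<subseteq> span (F \<union> M)"
        if "F' \<in> \<F>" "\<not> X \<subseteq> F'" for F'
        by (rule intersecting_iff_subset_span[OF F dM member[OF that(1)] member_not_above_X(1,3)[OF that]])
      then show ?thesis unfolding C_iff by metis
    qed
    also have "\<dots> \<longleftrightarrow> dim (F \<inter> C) + k = dim C + t"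
      by (rule subset_span_iff[OF F dM sC MC])
    finally show ?thesis .
  qed
  obtain F' where F': "F' \<in> \<F>" "\<not> X \<subseteq> F'" using exists_member_avoiding[OF subspace_X dim_X] .
  have dC: "k + 1 \<le> dim C" using dim_subset[OF EC[OF F']] member_not_above_X(2)[OF F'] by simp
  have not_above: "F \<in> family_C scale k t X M D" if F: "F \<in> \<F>" "\<not> X \<subseteq> F" "F \<subseteq> D" for F D
    using Fk[OF F(1)] F(3) member_not_above_X(1,4)[OF F(1,2)] dM
    by (simp add: family_C_def Int_commute)
  have A: "F \<in> family_A scale k t X M" if "F \<in> \<F>" "X \<subseteq> F" "Suc t \<le> dim (F \<inter> M)" for F
    using that Fk by (simp add: family_A_def)
  have A': "F \<in> \<F>" if "F \<in> family_A scale k t X M" for F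
    using that by (intro memberI_star) (auto simp: family_A_def subspaces_def)
  \<comment> \<open>If \<open>dim C > 2k - t\<close>, then \<open>family_B\<close> is empty and \<open>C\<close> can be enlarged to the whole space.\<close>
  show ?thesis
  proof (cases "dim C \<le> 2 * k - t")
    case True
    have "\<F> = H2 scale k t X M C"
    proof (intro equalityI subsetI)
      fix F assume F: "F \<in> \<F>"
      show "F \<in> H2 scale k t X M C"
      proof (cases "X \<subseteq> F")
        case True
        show ?thesis using F True
        proof (cases rule: Int_M_cases)
          case 1
          then show ?thesis using A[OF F True] by (simp add: H2_def)
        next
          case 2
          then have "dim (F \<inter> C) = dim C - k + t"
            using in_iff[OF member(1)[OF F] member(2)[OF F] 2] F dC by simp
          then show ?thesis using Fk[OF F] 2 by (simp add: H2_def family_B_def)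
        qed
      next
        case False
        then show ?thesis using not_above[OF F False NC[OF F False]] by (simp add: H2_def)
      qed
    next
      fix F assume "F \<in> H2 scale k t X M C"
      then consider "F \<in> family_A scale k t X M" | "F \<in> family_B scale k t X M C"
        | "F \<in> family_C scale k t X M C" by (auto simp: H2_def)
      then show "F \<in> \<F>"
      proof cases
        case 1
        then show ?thesis by (rule A')
      next
        case 2
        then show ?thesis using in_iff[of F] dC by (auto simp: family_B_def subspaces_def)
      next
        case 3
        then have "F \<subseteq> C" by (simp add: family_C_def)
        then have "span (X \<union> F) \<subseteq> C" using X_subset_M MC sC by (intro span_minimal) auto
        moreover have "C \<subseteq> span (G \<union> M)" if "G \<in> \<F>" "G \<inter> M = X" for G
          using in_iff[of G] subset_span_iff[of G C] that member[OF that(1)] dM sC MC by blast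
        ultimately show ?thesis using family_C_member[OF dM 3] by (meson order_trans)
      qed
    qed
    then show ?thesis using that sC MC dC True by auto
  next
    case False
    have no: "G \<inter> M \<noteq> X" if "G \<in> \<F>" for G
    proof
      assume "G \<inter> M = X"
      then have "dim (G \<inter> C) + k = dim C + t" using in_iff that member by blast
      moreover have "dim (G \<inter> C) \<le> k" using dim_subset[of "G \<inter> C" G] member(2)[OF that] by simp
      ultimately show False using False by simp
    qed
    have "\<F> = H2 scale k t X M UNIV"
    proof (intro equalityI subsetI)
      fix F assume F: "F \<in> \<F>"
      show "F \<in> H2 scale k t X M UNIV"
      proof (cases "X \<subseteq> F")
        case True
        show ?thesis using F True
          by (cases rule: Int_M_cases) (use A[OF F True] no[OF F] in \<open>simp_all add: H2_def\<close>)
      next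
        case False
        then show ?thesis using not_above[OF F False] by (simp add: H2_def)
      qed
    next
      fix F assume "F \<in> H2 scale k t X M UNIV"
      then consider "F \<in> family_A scale k t X M" | "F \<in> family_B scale k t X M UNIV"
        | "F \<in> family_C scale k t X M UNIV" by (auto simp: H2_def)
      then show "F \<in> \<F>"
      proof cases
        case 1
        then show ?thesis by (rule A')
      next
        \<comment> \<open>With \<open>C\<close> the whole space the condition of
          \<open>family_B\<close> would read \<open>k = n - k + t\<close>, which the size of
          \<open>n\<close> excludes.\<close>
        case 2
        then show ?thesis using dim_UNIV_eq n_ge by (auto simp: family_B_def subspaces_def)
      next
        case 3
        then show ?thesis using family_C_member[OF dM 3] no by blast
      qed
    qed
    then show ?thesis using that[of UNIV] dim_UNIV_eq by auto
  qed
qed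

end

section \<open>Classification\<close>

context nontrivial_family
begin

section \<open>Bounds for smallest covers of dimension above \<open>t + 1\<close>\<close>

lemma num_above_decay:
  assumes "s \<le> k"
  shows "real q ^ (n - k) * num_above (Suc s) \<le> num_above s"
proof (cases "s < k")
  case True
  have "1 < real q ^ (k - s)" using True q_gt_1 by (intro one_less_power) auto
  moreover have "real q ^ (n - k) * (real q ^ (k - s) - 1) \<le> real q ^ (n - s) - 1"
  proof -
    have "n - s = (n - k) + (k - s)" using True n_ge by simp
    moreover have "1 \<le> real q ^ (n - k)" using q_gt_1 by simp
    ultimately show ?thesis by (simp add: power_add algebra_simps)
  qed
  ultimately have "real q ^ (n - k) \<le> (real q ^ (n - s) - 1) / (real q ^ (k - s) - 1)"
    by (simp add: pos_le_divide_eq)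
  then show ?thesis unfolding num_above_Suc[OF True]
    using num_above_nonneg[of "Suc s"] True n_ge by (intro mult_right_mono) auto
next
  case False
  then show ?thesis using assms by (simp add: num_above_def)
qed

text \<open>The bound of \<open>card_family_le_chain\<close> for a smallest cover of dimension
  \<open>m\<close>.\<close>

definition chain_bound :: "nat \<Rightarrow> real" where
  "chain_bound m = gauss_binomial q (int m) (int t) * (q_number q (k + 1 - t) ^ (m - t) * num_above m)"

text \<open>From \<open>m\<close> to \<open>m + 1\<close> the binomial grows by at most
  \<open>2 * q^t\<close> and a factor below \<open>q^(k+1-t)\<close> is added, in total at most
  \<open>q^(k+2)\<close>; \<open>num_above\<close> drops by at least \<open>q^(n-k)\<close>, which
  is no less.\<close>

lemma chain_bound_Suc_le:
  assumes "t < m" "m \<le> k"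
  shows "chain_bound (Suc m) \<le> chain_bound m"
proof -
  define g where "g = gauss_binomial q (int m) (int t)"
  define b where "b = q_number q (k + 1 - t)"
  have g0: "0 \<le> g" using gauss_binomial_pos[OF q_ge_2, of t m] assms by (simp add: g_def)
  have b0: "0 \<le> b" "b \<le> real q ^ (k + 1 - t)"
    using q_number_nonneg[OF q_ge_2] q_number_less[OF q_ge_2, of "k + 1 - t"] by (simp_all add: b_def)
  have na: "0 \<le> num_above (Suc m)" using num_above_nonneg n_ge assms by simp
  define A where "A = real q ^ (Suc m - t)"
  have A: "2 \<le> A"
  proof -
    have "2 \<le> real q" using q_ge_2 by simp
    also have "\<dots> \<le> A" unfolding A_def using q_gt_1 assms by (intro self_le_power) auto
    finally show ?thesis .
  qed
  have "gauss_binomial q (int (Suc m)) (int t) * (A - 1) = (real q ^ Suc m - 1) * g"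
    using gauss_binomial_Suc_left[OF q_ge_2, of t m] assms unfolding A_def g_def by simp
  also have "\<dots> \<le> real q ^ t * (2 * (A - 1)) * g"
  proof (rule mult_right_mono[OF _ g0])
    have "real q ^ Suc m = real q ^ t * A"
      unfolding A_def power_add[symmetric] using assms by simp
    also have "\<dots> \<le> real q ^ t * (2 * (A - 1))" using A by (intro mult_left_mono) auto
    finally show "real q ^ Suc m - 1 \<le> real q ^ t * (2 * (A - 1))" by simp
  qed
  also have "\<dots> = (2 * real q ^ t * g) * (A - 1)" by (simp only: mult_ac)
  finally have "gauss_binomial q (int (Suc m)) (int t) * (A - 1) \<le> (2 * real q ^ t * g) * (A - 1)" .
  then have gS: "gauss_binomial q (int (Suc m)) (int t) \<le> 2 * real q ^ t * g"
    using A by simp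
  have "2 * real q ^ t * b * num_above (Suc m) \<le> real q ^ (n - k) * num_above (Suc m)"
  proof (rule mult_right_mono[OF _ na])
    have "2 * real q ^ t * b \<le> real q * real q ^ t * real q ^ (k + 1 - t)"
      using q_ge_2 b0 by (intro mult_mono) auto
    also have "\<dots> = real q ^ (Suc t + (k + 1 - t))" by (simp only: power_add power_Suc)
    also have "\<dots> \<le> real q ^ (n - k)" using n_ge t_less q_gt_1 by (intro power_increasing) auto
    finally show "2 * real q ^ t * b \<le> real q ^ (n - k)" .
  qed
  also have "\<dots> \<le> num_above m" by (rule num_above_decay[OF assms(2)])
  finally have step: "2 * real q ^ t * b * num_above (Suc m) \<le> num_above m" .
  have "chain_bound (Suc m) \<le> 2 * real q ^ t * g * (b ^ (Suc m - t) * num_above (Suc m))"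
    unfolding chain_bound_def b_def[symmetric] using gS b0 na by (intro mult_right_mono) auto
  also have "\<dots> = (g * b ^ (m - t)) * (2 * real q ^ t * b * num_above (Suc m))"
    using assms by (simp add: Suc_diff_le mult_ac)
  also have "\<dots> \<le> (g * b ^ (m - t)) * num_above m"
    using step g0 b0 by (intro mult_left_mono) auto
  finally show ?thesis by (simp add: chain_bound_def g_def b_def mult_ac)
qed

lemma chain_bound_antimono:
  assumes "t < m\<^sub>0" "m\<^sub>0 \<le> m" "m \<le> k"
  shows "chain_bound m \<le> chain_bound m\<^sub>0"
  using assms(2,3)
proof (induction m rule: dec_induct)
  case (step m)
  then show ?case using chain_bound_Suc_le[of m] assms(1) by simp
qed simp

lemma large_family_classification:
  assumes n_ge': "2 * k + t + min 4 (2 * t) \<le> n"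
    and large: "gauss_binomial q (int k - int t) 1
             * gauss_binomial q (int n - int t - 1) (int k - int t - 1)
           - real q * gauss_binomial q (int k - int t) 2
             * gauss_binomial q (int n - int t - 2) (int k - int t - 2) \<le> real (card \<F>)"
  shows "(\<exists>c X M C. c \<in> {k + 1..2 * k - t} \<union> {n} \<and>
             X \<in> subspaces scale t \<and> M \<in> subspaces scale k \<and> C \<in> subspaces scale c \<and>
             X \<subseteq> M \<and> M \<subseteq> C \<and> \<F> = H2 scale k t X M C)
       \<or> ((\<exists>Z \<in> subspaces scale (t + 2). \<F> = H3 scale k t Z) \<and> real k / 2 - 1 \<le> real t)"
proof -
  define e where "e = k - t - 1"
  have e: "0 < e" "k - t = Suc e" "k + 1 - t = Suc (Suc e)" "k - Suc t = e" "k = t + Suc e"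
    using t_less by (auto simp: e_def)
  \<comment> \<open>\<open>\<rho>\<close> is
    \<open>num_above (Suc t) / num_above (Suc (Suc t))\<close>. All upper bounds for the family and
    the threshold \<open>R * N\<close> are multiples of \<open>N\<close>, so comparing the
    coefficients suffices.\<close>
  define \<rho> where "\<rho> = (real q ^ (n - Suc t) - 1) / (real q ^ e - 1)"
  define N where "N = num_above (Suc (Suc t))"
  have N: "0 < N"
  proof -
    have "int n - int (Suc (Suc t)) = int (n - Suc (Suc t))"
      "int k - int (Suc (Suc t)) = int (k - Suc (Suc t))" using n_ge t_less by auto
    then show ?thesis unfolding N_def num_above_def
      using n_ge by (simp only:) (intro gauss_binomial_pos[OF q_ge_2], simp)
  qed
  have num: "num_above (Suc t) = \<rho> * N"
    using num_above_Suc[of "Suc t"] t_less by (simp add: \<rho>_def N_def e)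
  have qe: "1 < real q ^ e" using e(1) q_gt_1 by (intro one_less_power) auto
  have \<rho>_eq: "\<rho> * q_number q e = q_number q (n - Suc t)"
    using qe by (simp add: \<rho>_def q_number_def)
  have \<rho>_ge: "real q ^ d \<le> \<rho>" if "d \<le> n - k" for d
  proof -
    have "n - Suc t = (n - k) + e" using e(5) n_ge by simp
    then have "real q ^ (n - k) * q_number q e \<le> \<rho> * q_number q e"
      unfolding \<rho>_eq using q_number_add[OF q_ge_2, of "n - k" e] q_number_nonneg[OF q_ge_2] by simp
    then have "real q ^ (n - k) \<le> \<rho>" using q_number_pos[OF q_ge_2 e(1)] by simp
    moreover have "real q ^ d \<le> real q ^ (n - k)" using that q_gt_1 by (intro power_increasing) auto
    ultimately show ?thesis by simp
  qed
  define R where "R = q_number q (Suc e) * \<rho> - real q * (q_number q (Suc e) * q_number q e / (real q + 1))"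
  have card_ge: "R * N \<le> real (card \<F>)"
  proof -
    have "gauss_binomial q (int k - int t) 1 = q_number q (Suc e)"
      using gauss_binomial_1[of q "Suc e"] e(5) by simp
    moreover have "gauss_binomial q (int n - int t - 1) (int k - int t - 1) = \<rho> * N"
      unfolding num[symmetric] num_above_def by (simp add: algebra_simps)
    moreover have "gauss_binomial q (int n - int t - 2) (int k - int t - 2) = N"
      unfolding N_def num_above_def by (simp add: algebra_simps)
    moreover have "gauss_binomial q (int k - int t) 2 = q_number q (Suc e) * q_number q e / (real q + 1)"
    proof -
      have "int k - int t = int (Suc e)" using e(5) by simp
      then have "gauss_binomial q (int k - int t) 2 = gauss_binomial q (int (Suc e)) (int (Suc 1))"
        by simp
      also have "\<dots> = (real q ^ Suc e - 1) / (real q ^ 2 - 1) * q_number q e"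
        unfolding gauss_binomial_Suc using gauss_binomial_1[of q e] by (simp add: numeral_2_eq_2)
      also have "real q ^ 2 - 1 = (real q - 1) * (real q + 1)"
        by (simp add: power2_eq_square algebra_simps)
      finally show ?thesis by (simp add: q_number_def[of q "Suc e"])
    qed
    ultimately show ?thesis using large by (simp add: R_def algebra_simps)
  qed
  have small: False if "real (card \<F>) \<le> c * N" "c < R" for c
    using that card_ge N mult_strict_right_mono[OF that(2) N] by linarith
  \<comment> \<open>The left side is \<open>k + t + 2\<close>.\<close>
  have d3: "e + 2 * t + 3 \<le> n - k" using n_ge e(5) by simp
  show ?thesis
  proof (cases "\<exists>T. cover T \<and> dim T = Suc t")
    case True
    then obtain T where T: "cover T" "dim T = Suc t" by blast
    show ?thesis
    proof (cases "\<exists>T'. cover T' \<and> dim T' = Suc t \<and> T' \<noteq> T")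
      case False
      then have "real (card \<F>) \<le>
          (\<rho> + q_number q (Suc t) * (real q * q_number q (Suc e) * q_number q (Suc (Suc e)))) * N"
        using card_family_unique_cover[OF T] unfolding e(2,3) num N_def[symmetric]
        by (auto simp: algebra_simps)
      then have False
      proof (rule small)
        show "\<rho> + q_number q (Suc t) * (real q * q_number q (Suc e) * q_number q (Suc (Suc e))) < R"
          unfolding R_def using n_ge e(5)
          by (intro unique_cover_bound_less[OF q_ge_2 e(1) t_pos \<rho>_eq]) simp
      qed
      then show ?thesis ..
    next
      case True
      then obtain T' where T': "cover T'" "dim T' = Suc t" "T' \<noteq> T" by blast
      let ?X = "T \<inter> T'"
      have X: "subspace ?X" "dim ?X = t"
        using T T' subspace_inter cover_subspace dim_cover_Int by auto
      then have Xt: "?X \<in> subspaces scale t" by (simp add: subspaces_def)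
      show ?thesis
      proof (cases "\<forall>S. cover S \<longrightarrow> dim S = Suc t \<longrightarrow> ?X \<subseteq> S")
        case True
        interpret star_family scale Basis q n k t \<F> ?X
        proof unfold_locales
          show "subspace ?X" "dim ?X = t" by (fact X)+
          show "?X \<subseteq> S" if "cover S" "dim S = Suc t" for S using True that by simp
          show "\<exists>S S'. cover S \<and> cover S' \<and> dim S = Suc t \<and> dim S' = Suc t \<and> S \<noteq> S'"
            using T T' by metis
        qed
        define j where "j = dim M - t"
        have j: "dim M = t + j" "2 \<le> j" "j \<le> Suc (Suc e)"
          using dim_M_ge dim_M_le e(5) by (auto simp: j_def)
        \<comment> \<open>The cases are \<open>dim M = k + 1\<close>, \<open>dim M = k\<close> and
          \<open>dim M < k\<close>.\<close>
        consider "j = Suc (Suc e)" | "j = Suc e" | "j \<le> e" using j(3) by linarith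
        then show ?thesis
        proof cases
          case 1
          then have dM: "dim M = Suc k" using j e(5) by simp
          then obtain M' where M': "subspace M'" "?X \<subseteq> M'" "M' \<subseteq> M" "dim M' = k"
            using intermediate_subspace[OF subspace_X subspace_M X_subset_M, of k] dim_X t_less by auto
          have "M' \<in> subspaces scale k" "M \<in> subspaces scale (k + 1)"
            using M' dM subspace_M by (simp_all add: subspaces_def)
          moreover have "k + 1 \<le> 2 * k - t" using t_less by linarith
          then have "k + 1 \<in> {k + 1..2 * k - t} \<union> {n}" by simp
          ultimately show ?thesis using star_eq_H2_Suc[OF dM M'] Xt M'(2,3) by blast
        next
          case 2
          then have dM: "dim M = k" using j e(5) by simp
          obtain C where C: "subspace C" "M \<subseteq> C" "dim C \<in> {k + 1..2 * k - t} \<union> {n}"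
            "\<F> = H2 scale k t ?X M C" using star_eq_H2[OF dM] .
          have "M \<in> subspaces scale k" "C \<in> subspaces scale (dim C)"
            using C(1) dM subspace_M by (simp_all add: subspaces_def)
          then show ?thesis using C Xt X_subset_M by blast
        next
          case 3
          have "Suc k - t - j = Suc (Suc e) - j" using e(5) by simp
          then have "real (card \<F>) \<le> (q_number q j * \<rho> +
              (real q ^ j * q_number q (Suc (Suc e) - j) + q_number q (t + j)) *
                q_number q (Suc (Suc e))) * N"
            using card_family_star[OF j(1)] 3 e(2,3) unfolding num N_def[symmetric]
            by (simp add: algebra_simps)
          then have False
          proof (rule small)
            show "q_number q j * \<rho> + (real q ^ j * q_number q (Suc (Suc e) - j) +
                q_number q (t + j)) * q_number q (Suc (Suc e)) < R"
              unfolding R_def by (rule star_bound_less[OF q_ge_2 t_pos j(2) 3 \<rho>_ge[OF d3]])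
          qed
          then show ?thesis ..
        qed
      next
        case False
        then obtain S where S: "cover S" "dim S = Suc t" "\<not> ?X \<subseteq> S" by blast
        obtain Z where Z: "subspace Z" "dim Z = t + 2" "\<F> = H3 scale k t Z"
          using family_eq_H3[OF T(1) T'(1) S(1) T(2) T'(2) S(2)] T'(3) S(3) by metis
        have "real k / 2 - 1 \<le> real t"
        proof (rule ccontr)
          assume "\<not> real k / 2 - 1 \<le> real t"
          then have "t + 2 \<le> e" using e(5) by linarith
          moreover have "real (card \<F>) \<le> (q_number q (t + 2) * \<rho>) * N"
            using card_family_H3[OF Z] unfolding num by (simp add: mult_ac)
          ultimately show False
            using small H3_bound_less[OF q_ge_2 _ \<rho>_ge[OF d3]] unfolding R_def by blast
        qed
        moreover have "Z \<in> subspaces scale (t + 2)" using Z by (simp add: subspaces_def)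
        ultimately show ?thesis using Z(3) by blast
      qed
    qed
  next
    case False
    obtain F where F: "F \<in> \<F>" using family_nonempty by blast
    define m where "m = (LEAST m. \<exists>C. cover C \<and> dim C = m)"
    have "\<exists>C. cover C \<and> dim C = m"
      unfolding m_def by (rule LeastI_ex) (use member_cover[OF F] in blast)
    then obtain C where C: "cover C" "dim C = m" by blast
    have least: "\<not> cover S" if "dim S < m" for S
      using that not_less_Least[of "dim S"] unfolding m_def by blast
    have "\<not> k < m" using least[of F] member_cover[OF F] member(2)[OF F] by auto
    then have mk: "m \<le> k" by simp
    have mt: "t + 2 \<le> m"
    proof (rule ccontr)
      assume "\<not> t + 2 \<le> m"
      then have "m \<le> t \<or> m = Suc t" by linarith
      then show False using not_cover[OF cover_subspace[OF C(1)]] C False by blast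
    qed
    have "real (card \<F>) \<le> chain_bound (dim C)"
      unfolding chain_bound_def using least C(2) mk n_ge by (intro card_family_le_chain[OF C(1)]) auto
    then have chain: "real (card \<F>) \<le> chain_bound m" using C(2) by simp
    have False
    proof (cases "2 \<le> t")
      case True
      have "real (card \<F>) \<le> chain_bound (Suc (Suc t))"
        using chain chain_bound_antimono[of "Suc (Suc t)" m] mt mk by simp
      also have "\<dots> = (gauss_binomial q (int (Suc (Suc t))) (int t) * q_number q (Suc (Suc e)) ^ 2) * N"
        unfolding chain_bound_def N_def e(3) by simp
      finally show False
      proof (rule small)
        \<comment> \<open>For \<open>t \<ge> 2\<close> the minimum in the hypothesis on
          \<open>n\<close> is 4, two more than for \<open>t = 1\<close>.\<close>
        have "e + 2 * t + 5 \<le> n - k" using n_ge' True e(5) by simp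
        then show "gauss_binomial q (int (Suc (Suc t))) (int t) * q_number q (Suc (Suc e)) ^ 2 < R"
          unfolding R_def by (intro chain_bound_less[OF q_ge_2 e(1) True] \<rho>_ge)
      qed
    next
      case False
      then have t1: "t = 1" using t_pos by simp
      have d5: "e + 5 \<le> n - k" using n_ge e(5) t1 by simp
      have N3: "N = num_above 3" by (simp add: N_def t1 numeral_3_eq_3)
      have ek: "Suc (Suc e) = k" using e(5) t1 by simp
      define w where "w = num_above 4 / N"
      have wN: "num_above 4 = w * N" using N by (simp add: w_def)
      have w: "0 \<le> w" "real q ^ (e + 5) * w \<le> 1"
      proof -
        have n4: "0 \<le> num_above 4" using num_above_nonneg n_ge t_less by simp
        then show "0 \<le> w" using N by (simp add: w_def)
        have "real q ^ (e + 5) * num_above 4 \<le> real q ^ (n - k) * num_above 4"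
          using d5 q_gt_1 n4 by (intro mult_right_mono power_increasing) auto
        also have "\<dots> \<le> N" using num_above_decay[of 3] t_less t1 N3 by simp
        finally show "real q ^ (e + 5) * w \<le> 1" using N by (simp add: w_def)
      qed
      note \<rho>5 = \<rho>_ge[OF d5]
      show False
      proof (cases "m = 3")
        case True
        show False
        proof (cases "\<exists>P. subspace P \<and> dim P = 1 \<and> P \<subseteq> C \<and>
            (\<forall>T. cover T \<longrightarrow> dim T = 3 \<longrightarrow> P \<subseteq> T)")
          case common: True
          then obtain P where P: "subspace P" "dim P = 1" "P \<subseteq> C"
            "\<And>T. cover T \<Longrightarrow> dim T = 3 \<Longrightarrow> P \<subseteq> T" by blast
          have "real (card \<F>) \<le> q_number q k ^ 2 * num_above 3 +
              (q_number q 3 - 1) * (q_number q k ^ 3 * num_above 4)"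
            using least C True by (intro card_family_common_point[OF t1 C(1) _ P(1-3) _ P(4)]) auto
          then have "real (card \<F>) \<le> (q_number q (Suc (Suc e)) ^ 2 +
              (q_number q 3 - 1) * (q_number q (Suc (Suc e)) ^ 3 * w)) * N"
            unfolding ek wN N3[symmetric] by (simp add: algebra_simps)
          then show False
            by (rule small) (unfold R_def, rule common_point_bound_less[OF q_ge_2 e(1) w \<rho>5])
        next
          case no_common: False
          have "real (card \<F>) \<le> (q_number q 3 ^ 2 * q_number q (Suc (Suc e))) * N"
            unfolding N3 ek using least C True no_common
            by (intro card_family_no_common_point[OF t1 C(1)]) auto
          then show False
          proof (rule small)
            have "2 * e + 5 \<le> n - Suc t" using n_ge e(5) t1 by simp
            then show "q_number q 3 ^ 2 * q_number q (Suc (Suc e)) < R"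
              unfolding R_def by (rule no_common_point_bound_less[OF q_ge_2 e(1) \<rho>_eq _ \<rho>5])
          qed
        qed
      next
        case False
        then have m4: "4 \<le> m" using mt t1 by simp
        have "real (card \<F>) \<le> chain_bound 4"
          using chain chain_bound_antimono[of 4 m] m4 mk t1 by simp
        also have "\<dots> = (q_number q 4 * (q_number q (Suc (Suc e)) ^ 3 * w)) * N"
          using gauss_binomial_1[of q 4] unfolding chain_bound_def by (simp add: t1 ek wN)
        finally show False
          by (rule small) (unfold R_def, rule chain_bound_less_1[OF q_ge_2 e(1) w \<rho>5])
      qed
    qed
    then show ?thesis ..
  qed
qed

end

theorem theorem1p1:
  fixes s :: "'f::{field,finite} \<Rightarrow> 'v::ab_group_add \<Rightarrow> 'v"
    and q n k t :: nat
    and \<F> :: "'v set set"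
  assumes "q = CARD('f)"
    and "n > 0" and "k > 0" and "t > 0"
    and "t + 2 \<le> k"
    and "2 * k + t + min 4 (2 * t) \<le> n"
    and "vector_space s"
    and "vector_space.dim s UNIV = n"
    and "maximal_t_intersecting s k t \<F>"
    and "\<not> trivial_family s t \<F>"
    and "real (card \<F>) \<ge>
           gauss_binomial q (int k - int t) 1
             * gauss_binomial q (int n - int t - 1) (int k - int t - 1)
           - real q * gauss_binomial q (int k - int t) 2
             * gauss_binomial q (int n - int t - 2) (int k - int t - 2)"
  shows "(\<exists>c X M C. c \<in> {k + 1..2 * k - t} \<union> {n} \<and>
             X \<in> subspaces s t \<and> M \<in> subspaces s k \<and> C \<in> subspaces s c \<and>
             X \<subseteq> M \<and> M \<subseteq> C \<and> \<F> = H2 s k t X M C)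
       \<or> ((\<exists>Z \<in> subspaces s (t + 2). \<F> = H3 s k t Z) \<and>
            real k / 2 - 1 \<le> real t \<and> t + 2 \<le> k)"
proof -
  interpret vector_space s by fact
  obtain B where B: "independent B" "UNIV \<subseteq> span B" "card B = dim UNIV"
    using basis_exists[of UNIV] by blast
  \<comment> \<open>An infinite set has \<open>card\<close> equal to 0, so \<open>n > 0\<close>
    forces the basis to be finite.\<close>
  have "card B > 0" using B(3) assms(2,8) by simp
  then have "finite B" by (simp add: card_gt_0_iff)
  then interpret nontrivial_family s B q n k t \<F>
    using B assms by unfold_locales auto
  show ?thesis using large_family_classification assms by auto
qed

end
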